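(* The eigenpairs of the rectangular Raviart-Thomas eigenvalue problem, $(\lambda_h^{\rm RRT},\boldsymbol\sigma_h^{\rm RRT},u_h^{\rm RRT})\in\mathbb R\times\boldsymbol\Sigma_h\times V_h$ with $\|u_h^{\rm RRT}\|_0=1$ and $$(\boldsymbol\sigma_h^{\rm RRT},\boldsymbol\tau_h)-(\operatorname{div}\boldsymbol\tau_h,u_h^{\rm RRT})=0,\quad(\operatorname{div}\boldsymbol\sigma_h^{\rm RRT},v_h)=\lambda_h^{\rm RRT}(u_h^{\rm RRT},v_h)\quad\forall(\boldsymbol\tau_h,v_h)\in\boldsymbol\Sigma_h\times V_h,$$ and the eigenpairs of the projected $\mathrm{E}Q_1^{\rm rot}$ eigenvalue problem, $(\lambda_h^{\rm PEQ},u_h^{\rm PEQ})\in\mathbb R\times V_h^{\rm EQ}$ with $\|\Pi_0u_h^{\rm PEQ}\|_0=1$ and $$(\nabla_hu_h^{\rm PEQ},\nabla_hv_h)=\lambda_h^{\rm PEQ}(\Pi_0u_h^{\rm PEQ},v_h)\quad\forall v_h\in V_h^{\rm EQ},$$ are in one-to-one correspondence, and corresponding eigenpairs satisfy $$\lambda_h^{\rm RRT}=\lambda_h^{\rm PEQ},\qquad\boldsymbol\sigma_h^{\rm RRT}=-\nabla_hu_h^{\rm PEQ},\qquad u_h^{\rm RRT}=\Pi_0u_h^{\rm PEQ}.$$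
   Context: $\Omega\subset\mathbb R^2$ is a connected bounded domain that can be divided into non-overlapping axis-parallel rectangles without hanging nodes, and $\mathcal T_h$ is a mesh of $\overline\Omega$ consisting of the cells $[x_{i-1},x_i]\times[y_{j-1},y_j]\subset\overline\Omega$ of a grid $x_0<\dots<x_{n_1}$, $y_0<\dots<y_{n_2}$. $\mathcal E_h$ is the set of all edges of $\mathcal T_h$. $\llbracket v\rrbracket_e$ is the jump of $v$ across $e$ (the trace of $v$ if $e\subset\partial\Omega$). $\nabla_h$ is the elementwise gradient; $(\cdot,\cdot)$, $\|\cdot\|_0$ are the $L^2(\Omega)$ inner product and norm. With $Q_{mn}=\operatorname{span}\{x^iy^j:0\le i\le m,0\le j\le n\}$: $\boldsymbol\Sigma_h=\{\boldsymbol\tau_h\in\boldsymbol H(\operatorname{div},\Omega):\boldsymbol\tau_h|_K\in Q_{10}(K)\times Q_{01}(K)\ \forall K\in\mathcal T_h\}$; $V_h=\{v_h\in L^2(\Omega):v_h|_K\text{ constant }\forall K\in\mathcal T_h\}$; $\Pi_0$ is the $L^2$-orthogonal projection onto $V_h$. The $\mathrm{E}Q_1^{\rm rot}$ space is $V_h^{\rm EQ}=\{v_h\in L^2(\Omega):v_h|_K\in\operatorname{span}\{1,x,y,x^2,y^2\}\ \forall K\in\mathcal T_h,\ \int_e\llbracket v_h\rrbracket_e\,de=0\ \forall e\in\mathcal E_h\}$. *)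

theory Defs
  imports "HOL-Analysis.Analysis"
begin

type_synonym point = "real \<times> real"

definition L2 :: "point set \<Rightarrow> (point \<Rightarrow> 'b::euclidean_space) set" where
  "L2 \<Omega> = {f \<in> borel_measurable (lebesgue_on \<Omega>).
             integrable (lebesgue_on \<Omega>) (\<lambda>z. (norm (f z))\<^sup>2)}"

definition l2_inner :: "point set \<Rightarrow> (point \<Rightarrow> 'b::euclidean_space) \<Rightarrow> (point \<Rightarrow> 'b) \<Rightarrow> real" where
  "l2_inner \<Omega> f g = (LINT z|lebesgue_on \<Omega>. f z \<bullet> g z)"

definition l2_norm :: "point set \<Rightarrow> (point \<Rightarrow> 'b::euclidean_space) \<Rightarrow> real" where
  "l2_norm \<Omega> f = sqrt (l2_inner \<Omega> f f)"

definition grad :: "(point \<Rightarrow> real) \<Rightarrow> point \<Rightarrow> point" where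
  "grad f z = (frechet_derivative f (at z) (1, 0), frechet_derivative f (at z) (0, 1))"

primrec Ck :: "nat \<Rightarrow> (point \<Rightarrow> real) \<Rightarrow> bool" where
  "Ck 0 f \<longleftrightarrow> continuous_on UNIV f"
| "Ck (Suc k) f \<longleftrightarrow> f differentiable_on UNIV \<and>
     Ck k (\<lambda>z. fst (grad f z)) \<and> Ck k (\<lambda>z. snd (grad f z))"

definition test_functions :: "point set \<Rightarrow> (point \<Rightarrow> real) set" where
  "test_functions \<Omega> = {\<phi>. (\<forall>k. Ck k \<phi>) \<and>
     compact (closure {z. \<phi> z \<noteq> 0}) \<and> closure {z. \<phi> z \<noteq> 0} \<subseteq> \<Omega>}"

definition is_weak_div :: "point set \<Rightarrow> (point \<Rightarrow> point) \<Rightarrow> (point \<Rightarrow> real) \<Rightarrow> bool" where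
  "is_weak_div \<Omega> \<tau> d \<longleftrightarrow>
     (\<forall>\<phi>\<in>test_functions \<Omega>. l2_inner \<Omega> \<tau> (grad \<phi>) = - l2_inner \<Omega> d \<phi>)"

definition Hdiv :: "point set \<Rightarrow> (point \<Rightarrow> point) set" where
  "Hdiv \<Omega> = {\<tau> \<in> L2 \<Omega>. \<exists>d\<in>L2 \<Omega>. is_weak_div \<Omega> \<tau> d}"

text \<open>The weak divergence is determined only almost everywhere on the domain; it is used
  only inside integrals, so the choice of representative is immaterial.\<close>

definition weak_div :: "point set \<Rightarrow> (point \<Rightarrow> point) \<Rightarrow> point \<Rightarrow> real" where
  "weak_div \<Omega> \<tau> = (SOME d. d \<in> L2 \<Omega> \<and> is_weak_div \<Omega> \<tau> d)"

text \<open>A cell is given by its lower left and upper right corners \<open>(a, b)\<close>; the closed cell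
  is \<open>cbox a b\<close> and its interior is \<open>box a b\<close>.\<close>

type_synonym cell = "point \<times> point"

definition mesh :: "point set \<Rightarrow> nat \<Rightarrow> (nat \<Rightarrow> real) \<Rightarrow> nat \<Rightarrow> (nat \<Rightarrow> real) \<Rightarrow> cell set" where
  "mesh \<Omega> n1 x n2 y =
     {((x (i - 1), y (j - 1)), (x i, y j)) | i j. i \<in> {1..n1} \<and> j \<in> {1..n2} \<and>
        cbox (x (i - 1), y (j - 1)) (x i, y j) \<subseteq> closure \<Omega>}"

text \<open>The closed cells fill up the closure of the domain.  The condition on the open cells
  makes the domain itself (and not just its closure) the union of the cells up to cell
  boundaries; otherwise its boundary could have positive measure inside a cell.\<close>

definition rect_mesh ::
  "point set \<Rightarrow> nat \<Rightarrow> (nat \<Rightarrow> real) \<Rightarrow> nat \<Rightarrow> (nat \<Rightarrow> real) \<Rightarrow> bool" where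
  "rect_mesh \<Omega> n1 x n2 y \<longleftrightarrow>
     strict_mono_on {0..n1} x \<and> strict_mono_on {0..n2} y \<and>
     (\<Union>(a, b)\<in>mesh \<Omega> n1 x n2 y. cbox a b) = closure \<Omega> \<and>
     (\<Union>(a, b)\<in>mesh \<Omega> n1 x n2 y. box a b) \<subseteq> \<Omega>"

text \<open>An edge is given by its left (lower) and right (upper) end point, so an edge shared by
  two cells of a grid is the same pair for both cells.\<close>

type_synonym edge = "point \<times> point"

fun cell_edges :: "cell \<Rightarrow> edge set" where
  "cell_edges ((a1, a2), (b1, b2)) =
     {((a1, a2), (b1, a2)), ((a1, b2), (b1, b2)), ((a1, a2), (a1, b2)), ((b1, a2), (b1, b2))}"

definition mesh_edges :: "cell set \<Rightarrow> edge set" where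
  "mesh_edges T = (\<Union>K\<in>T. cell_edges K)"

definition edge_integral :: "edge \<Rightarrow> (point \<Rightarrow> real) \<Rightarrow> real" where
  "edge_integral e f =
     dist (fst e) (snd e) * integral {0..1} (\<lambda>t. f (linepath (fst e) (snd e) t))"

definition cell_trace :: "cell \<Rightarrow> (point \<Rightarrow> real) \<Rightarrow> point \<Rightarrow> real" where
  "cell_trace K v z = Lim (at z within box (fst K) (snd K)) v"

text \<open>The jumps of \<open>v\<close> across \<open>e\<close>: for an edge not contained in the boundary these are the
  two differences of the one-sided traces (the sign depends on the order of the two
  cells), for a boundary edge it is the trace.  (On a boundary edge with cells on both
  sides, i.e. on a slit, both one-sided traces occur.)\<close>

definition jumps :: "point set \<Rightarrow> cell set \<Rightarrow> (point \<Rightarrow> real) \<Rightarrow> edge \<Rightarrow> (point \<Rightarrow> real) set" where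
  "jumps \<Omega> T v e =
     (if closed_segment (fst e) (snd e) \<subseteq> frontier \<Omega>
      then {cell_trace K v | K. K \<in> T \<and> e \<in> cell_edges K}
      else {(\<lambda>z. cell_trace K v z - cell_trace K' v z) | K K'.
              K \<in> T \<and> K' \<in> T \<and> K \<noteq> K' \<and> e \<in> cell_edges K \<and> e \<in> cell_edges K'})"

definition Q :: "nat \<Rightarrow> nat \<Rightarrow> (point \<Rightarrow> real) set" where
  "Q m n = {(\<lambda>(x, y). \<Sum>i\<le>m. \<Sum>j\<le>n. c i j * x ^ i * y ^ j) | c. True}"

definition EQ_shape :: "(point \<Rightarrow> real) set" where
  "EQ_shape = {(\<lambda>(x, y). a + b * x + c * y + d * x\<^sup>2 + e * y\<^sup>2) | a b c d e. True}"

definition QxQ :: "(point \<Rightarrow> point) set" where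
  "QxQ = {(\<lambda>z. (p z, q z)) | p q. p \<in> Q 1 0 \<and> q \<in> Q 0 1}"

text \<open>Elements of \<open>L\<^sup>2\<close> that coincide a.e. on every cell with a function from a shape space
  \<open>P\<close> are represented by functions: each class is given by its unique representative
  that coincides with an element of \<open>P\<close> everywhere on each open cell and vanishes outside
  of the open cells (apart from the open cells, the domain is a null set).  Equality of
  such elements of \<open>L\<^sup>2\<close> is thus equality of functions.\<close>

definition piecewise :: "cell set \<Rightarrow> (point \<Rightarrow> 'b::zero) set \<Rightarrow> (point \<Rightarrow> 'b) set" where
  "piecewise T P = {v. (\<forall>(a, b)\<in>T. \<exists>p\<in>P. \<forall>z\<in>box a b. v z = p z) \<and>
                       (\<forall>z. z \<notin> (\<Union>(a, b)\<in>T. box a b) \<longrightarrow> v z = 0)}"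

definition RT_space :: "point set \<Rightarrow> cell set \<Rightarrow> (point \<Rightarrow> point) set" where
  "RT_space \<Omega> T = Hdiv \<Omega> \<inter> piecewise T QxQ"

definition P0_space :: "point set \<Rightarrow> cell set \<Rightarrow> (point \<Rightarrow> real) set" where
  "P0_space \<Omega> T = L2 \<Omega> \<inter> piecewise T {(\<lambda>z. c) | c. True}"

definition EQ_space :: "point set \<Rightarrow> cell set \<Rightarrow> (point \<Rightarrow> real) set" where
  "EQ_space \<Omega> T = {v \<in> L2 \<Omega> \<inter> piecewise T EQ_shape.
     \<forall>e\<in>mesh_edges T. \<forall>j\<in>jumps \<Omega> T v e. edge_integral e j = 0}"

definition proj0 :: "point set \<Rightarrow> cell set \<Rightarrow> (point \<Rightarrow> real) \<Rightarrow> point \<Rightarrow> real" where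
  "proj0 \<Omega> T v = (THE w. w \<in> P0_space \<Omega> T \<and>
     (\<forall>q\<in>P0_space \<Omega> T. l2_inner \<Omega> (\<lambda>z. v z - w z) q = 0))"

definition grad_h :: "cell set \<Rightarrow> (point \<Rightarrow> real) \<Rightarrow> point \<Rightarrow> point" where
  "grad_h T v z = (if z \<in> (\<Union>(a, b)\<in>T. box a b) then grad v z else 0)"

definition RRT_eigenpairs ::
  "point set \<Rightarrow> cell set \<Rightarrow> (real \<times> (point \<Rightarrow> point) \<times> (point \<Rightarrow> real)) set" where
  "RRT_eigenpairs \<Omega> T = {(lam, \<sigma>, u). \<sigma> \<in> RT_space \<Omega> T \<and> u \<in> P0_space \<Omega> T \<and>
     l2_norm \<Omega> u = 1 \<and>
     (\<forall>\<tau>\<in>RT_space \<Omega> T. l2_inner \<Omega> \<sigma> \<tau> - l2_inner \<Omega> (weak_div \<Omega> \<tau>) u = 0) \<and>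
     (\<forall>v\<in>P0_space \<Omega> T. l2_inner \<Omega> (weak_div \<Omega> \<sigma>) v = lam * l2_inner \<Omega> u v)}"

definition PEQ_eigenpairs :: "point set \<Rightarrow> cell set \<Rightarrow> (real \<times> (point \<Rightarrow> real)) set" where
  "PEQ_eigenpairs \<Omega> T = {(lam, u). u \<in> EQ_space \<Omega> T \<and> l2_norm \<Omega> (proj0 \<Omega> T u) = 1 \<and>
     (\<forall>v\<in>EQ_space \<Omega> T.
        l2_inner \<Omega> (grad_h T u) (grad_h T v) = lam * l2_inner \<Omega> (proj0 \<Omega> T u) v)}"

end

theory Submission
  imports Defs
begin

text \<open>
  On a cell, an element of the Raviart--Thomas space and the gradient of an element of the
  \<open>EQ\<close> shape space have the same form \<open>(a + b x, c + d y)\<close>, with constant divergence and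
  constant normal component on each edge.  Integration by parts on each cell, summed over the
  mesh, therefore gives one term per edge: flux times edge mean, with opposite signs from the two
  sides.  It vanishes if fluxes and edge means match across the edges that meet \<open>\<Omega>\<close> and the edge
  means are zero on the others.  Since edge means and cell means are degrees of freedom of the
  \<open>EQ\<close> element, testing the projected eigenvalue equation with edge functions yields that the flux
  of \<open>grad u\<close> matches, that is, \<open>- grad u\<close> is in \<open>H(div)\<close>, and testing with cell bubbles yields
  \<open>div \<sigma> = \<lambda> \<Pi>\<^sub>0 u\<close>.  Conversely, \<open>- \<sigma>\<close> is a gradient on each cell, which together with the cell
  means \<open>u\<^sub>h\<close> defines \<open>u\<close>, and testing the mixed equation with edge flux functions yields that the
  edge means of \<open>u\<close> match.
\<close>

subsection \<open>Integration by parts on a cell\<close>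

text \<open>The obstacle is \<open>Hdiv\<close>: it is defined through smooth test functions, and
  \<open>weak_div\<close> through a choice, whereas the argument runs on finitely many coefficients
  per cell. Two facts bridge the gap. Matching of fluxes has to be extracted from the mere existence
  of a weak divergence in \<open>L2\<close>; this takes test functions that shrink onto an edge
  while their integral over it stays fixed, hence an explicit supply of smooth compactly supported
  functions. As fluxes are constant along an edge, one point of \<Omega> on the edge is enough.
  Secondly, the chosen divergence is only paired with piecewise constants, so it suffices that any
  two weak divergences have the same integral over each cell, which is again an approximation by
  test functions. Slits shape the bookkeeping: an edge contained in the frontier may have cells on
  both sides. There the two fluxes are independent and both edge means vanish, so an edge is
  classified by \<open>frontier \<Omega>\<close> and not by the number of its cells.\<close>

fun rt_fun :: "real \<times> real \<times> real \<times> real \<Rightarrow> point \<Rightarrow> point" where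
  "rt_fun (a, b, c, d) (x, y) = (a + b * x, c + d * y)"

fun rt_div :: "real \<times> real \<times> real \<times> real \<Rightarrow> real" where
  "rt_div (a, b, c, d) = b + d"

definition normal_comp :: "edge \<Rightarrow> point \<Rightarrow> real" where
  "normal_comp e q = (if fst (fst e) = fst (snd e) then fst q else snd q)"

text \<open>The left and the lower edge of a cell both start at its lower left corner.\<close>

definition osign :: "cell \<Rightarrow> edge \<Rightarrow> real" where
  "osign K e = (if fst e = fst K then - 1 else 1)"

text \<open>The normal component of \<open>rt_fun c\<close> is constant along an axis-parallel edge,
  so the value at the starting point stands for the whole edge. The normal always points in the
  positive coordinate direction; the orientation relative to a cell is left to
  \<open>osign\<close>.\<close>

definition flux :: "(real \<times> real \<times> real \<times> real) \<Rightarrow> edge \<Rightarrow> real" where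
  "flux c e = normal_comp e (rt_fun c (fst e))"

text \<open>Demanded on the whole plane: the functions inserted are polynomials or test functions,
  so one-sided derivatives at cell boundaries never arise.\<close>

definition C1 :: "(point \<Rightarrow> real) \<Rightarrow> bool" where
  "C1 u \<longleftrightarrow> (\<forall>z. u differentiable at z) \<and> continuous_on UNIV (grad u)"

lemma continuous_on_rt_fun: "continuous_on S (rt_fun c)"
proof -
  obtain a b d e where c: "c = (a, b, d, e)" by (metis prod_cases4)
  have "rt_fun c = (\<lambda>z. (a + b * fst z, d + e * snd z))"
    by (auto simp: c fun_eq_iff)
  then show ?thesis by (auto intro!: continuous_intros)
qed

lemma C1_continuous: "C1 u \<Longrightarrow> continuous_on S u"
  unfolding C1_def
  by (meson continuous_at_imp_continuous_on differentiable_imp_continuous_within)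

lemma C1_partials:
  assumes "C1 u"
  shows "((\<lambda>x. u (x, y)) has_real_derivative fst (grad u (x, y))) (at x within S)"
    and "((\<lambda>y. u (x, y)) has_real_derivative snd (grad u (x, y))) (at y within S')"
proof -
  let ?D = "frechet_derivative u (at (x, y))"
  have D: "(u has_derivative ?D) (at (x, y))"
    using assms by (simp add: C1_def frechet_derivative_works)
  then have lin: "linear ?D" by (rule has_derivative_linear)
  have "((\<lambda>x. u (x, y)) has_derivative (\<lambda>h. ?D (h, 0))) (at x within S)"
    by (rule has_derivative_compose[where f="\<lambda>x. (x, y)" and g=u, OF _ D])
      (auto intro!: derivative_eq_intros)
  moreover have "?D (h, 0) = fst (grad u (x, y)) * h" for h
    using linear_scale[OF lin, of h "(1, 0)"] by (simp add: grad_def)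
  ultimately show "((\<lambda>x. u (x, y)) has_real_derivative fst (grad u (x, y))) (at x within S)"
    by (simp add: has_field_derivative_def)
  have "((\<lambda>y. u (x, y)) has_derivative (\<lambda>h. ?D (0, h))) (at y within S')"
    by (rule has_derivative_compose[where f="\<lambda>y. (x, y)" and g=u, OF _ D])
      (auto intro!: derivative_eq_intros)
  moreover have "?D (0, h) = snd (grad u (x, y)) * h" for h
    using linear_scale[OF lin, of h "(0, 1)"] by (simp add: grad_def)
  ultimately show "((\<lambda>y. u (x, y)) has_real_derivative snd (grad u (x, y))) (at y within S')"
    by (simp add: has_field_derivative_def)
qed

lemma edge_integral_cong:
  assumes "\<And>z. z \<in> closed_segment (fst e) (snd e) \<Longrightarrow> f z = g z"
  shows "edge_integral e f = edge_integral e g"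
proof -
  have "integral {0..1} (\<lambda>t. f (linepath (fst e) (snd e) t)) = integral {0..1} (\<lambda>t. g (linepath (fst e) (snd e) t))"
    by (intro integral_cong assms linepath_in_path)
  then show ?thesis by (simp add: edge_integral_def)
qed

lemma edge_integral_eq_0:
  assumes "\<And>z. z \<in> closed_segment (fst e) (snd e) \<Longrightarrow> f z = 0"
  shows "edge_integral e f = 0"
  using edge_integral_cong[OF assms] by (simp add: edge_integral_def)

text \<open>The length factor in \<open>edge_integral\<close> is the Jacobian of the linear
  parametrisation, so the substitution \<open>?g\<close> leaves a plain integral in the coordinate
  along the edge.\<close>

lemma edge_integral_horizontal:
  assumes "p < r" "continuous_on (closed_segment (p, q) (r, q)) f"
  shows "edge_integral ((p, q), (r, q)) f = integral {p..r} (\<lambda>x. f (x, q))"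
proof -
  let ?g = "\<lambda>t. p + t * (r - p)"
  have seg: "closed_segment (p, q) (r, q) = {p..r} \<times> {q}"
    using assms(1) by (auto simp: closed_segment_PairD closed_segment_same_snd closed_segment_eq_real_ivl)
  have "((\<lambda>t. (r - p) *\<^sub>R f (?g t, q)) has_integral integral {?g 0..?g 1} (\<lambda>x. f (x, q))) {0..1}"
  proof (rule has_integral_substitution[where c=p and d=r])
    show "continuous_on {p..r} (\<lambda>x. f (x, q))"
      by (rule continuous_on_compose2[OF assms(2)]) (auto simp: seg intro!: continuous_intros)
    show "?g ` {0..1} \<subseteq> {p..r}"
    proof (rule image_subsetI)
      fix t :: real assume "t \<in> {0..1}"
      then have "0 \<le> t * (r - p)" "t * (r - p) \<le> r - p"
        using assms(1) by (auto intro: mult_left_le_one_le)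
      then show "?g t \<in> {p..r}" by auto
    qed
  qed (use assms(1) in \<open>auto intro!: derivative_eq_intros\<close>)
  then have "integral {0..1} (\<lambda>t. (r - p) *\<^sub>R f (?g t, q)) = integral {p..r} (\<lambda>x. f (x, q))"
    by - (drule integral_unique, simp)
  moreover have "linepath (p, q) (r, q) t = (?g t, q)" for t
    by (simp add: linepath_def algebra_simps)
  moreover have "dist (p, q) (r, q) = r - p"
    using assms(1) by (simp add: dist_Pair_Pair dist_real_def)
  ultimately show ?thesis
    by (simp add: edge_integral_def)
qed

lemma edge_integral_vertical:
  assumes "p < r" "continuous_on (closed_segment (q, p) (q, r)) f"
  shows "edge_integral ((q, p), (q, r)) f = integral {p..r} (\<lambda>x. f (q, x))"
proof -
  let ?g = "\<lambda>t. p + t * (r - p)"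
  have seg: "closed_segment (q, p) (q, r) = {q} \<times> {p..r}"
    using assms(1) by (auto simp: closed_segment_PairD closed_segment_same_fst closed_segment_eq_real_ivl)
  have "((\<lambda>t. (r - p) *\<^sub>R f (q, ?g t)) has_integral integral {?g 0..?g 1} (\<lambda>x. f (q, x))) {0..1}"
  proof (rule has_integral_substitution[where c=p and d=r])
    show "continuous_on {p..r} (\<lambda>x. f (q, x))"
      by (rule continuous_on_compose2[OF assms(2)]) (auto simp: seg intro!: continuous_intros)
    show "?g ` {0..1} \<subseteq> {p..r}"
    proof (rule image_subsetI)
      fix t :: real assume "t \<in> {0..1}"
      then have "0 \<le> t * (r - p)" "t * (r - p) \<le> r - p"
        using assms(1) by (auto intro: mult_left_le_one_le)
      then show "?g t \<in> {p..r}" by auto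
    qed
  qed (use assms(1) in \<open>auto intro!: derivative_eq_intros\<close>)
  then have "integral {0..1} (\<lambda>t. (r - p) *\<^sub>R f (q, ?g t)) = integral {p..r} (\<lambda>x. f (q, x))"
    by - (drule integral_unique, simp)
  moreover have "linepath (q, p) (q, r) t = (q, ?g t)" for t
    by (simp add: linepath_def algebra_simps)
  moreover have "dist (q, p) (q, r) = r - p"
    using assms(1) by (simp add: dist_Pair_Pair dist_real_def)
  ultimately show ?thesis
    by (simp add: edge_integral_def)
qed

lemma sum_cell_edges:
  assumes "a1 < b1" "a2 < b2"
  shows "(\<Sum>e\<in>cell_edges ((a1, a2), (b1, b2)). osign ((a1, a2), (b1, b2)) e * F e) =
    F ((b1, a2), (b1, b2)) - F ((a1, a2), (a1, b2)) + F ((a1, b2), (b1, b2)) - F ((a1, a2), (b1, a2))"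
  using assms by (simp add: osign_def)

text \<open>By the product rule the integrand is the divergence of \<open>u\<close> times
  \<open>rt_fun c\<close>; \<open>?X\<close> and \<open>?Y\<close> below are its x- and y-derivative
  parts. Each is integrated by the fundamental theorem in its own variable, and the constant normal
  component factors out of the remaining edge integral.\<close>

lemma green_cell:
  assumes u: "C1 u" and ab: "a1 < b1" "a2 < b2"
  defines "K \<equiv> ((a1, a2), (b1, b2))"
  shows "integral (cbox (a1, a2) (b1, b2)) (\<lambda>z. grad u z \<bullet> rt_fun c z + u z * rt_div c) =
    (\<Sum>e\<in>cell_edges K. osign K e * (flux c e * edge_integral e u))"
proof -
  obtain \<alpha> \<beta> \<gamma> \<delta> where c: "c = (\<alpha>, \<beta>, \<gamma>, \<delta>)" by (metis prod_cases4)
  let ?C = "cbox (a1, a2) (b1, b2)"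
  let ?X = "\<lambda>z. fst (grad u z) * (\<alpha> + \<beta> * fst z) + u z * \<beta>"
  let ?Y = "\<lambda>z. snd (grad u z) * (\<gamma> + \<delta> * snd z) + u z * \<delta>"
  have cu: "continuous_on S u" for S by (rule C1_continuous[OF u])
  have cg: "continuous_on S (grad u)" for S
    using u continuous_on_subset unfolding C1_def by blast
  have cX: "continuous_on S ?X" and cY: "continuous_on S ?Y" for S
    by (intro continuous_intros cu cg)+
  have cu1: "continuous_on S (\<lambda>x. u (x, y))" and cu2: "continuous_on S (\<lambda>y. u (x, y))" for S x y
    by (rule continuous_on_compose2[OF cu[of UNIV]], auto intro!: continuous_intros)+
  have iu1: "(\<lambda>x. u (x, y)) integrable_on {r..s}" and iu2: "(\<lambda>y. u (x, y)) integrable_on {r..s}" for r s x y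
    by (intro integrable_continuous_real cu1 cu2)+
  have X1: "integral {a1..b1} (\<lambda>x. ?X (x, y)) = (\<alpha> + \<beta> * b1) * u (b1, y) - (\<alpha> + \<beta> * a1) * u (a1, y)" for y
  proof -
    have "((\<lambda>x. ?X (x, y)) has_integral ((\<alpha> + \<beta> * b1) * u (b1, y) - (\<alpha> + \<beta> * a1) * u (a1, y))) {a1..b1}"
      using ab by (intro fundamental_theorem_of_calculus)
        (auto simp flip: has_real_derivative_iff_has_vector_derivative intro!: derivative_eq_intros C1_partials[OF u])
    then show ?thesis by (rule integral_unique)
  qed
  have Y1: "integral {a2..b2} (\<lambda>y. ?Y (x, y)) = (\<gamma> + \<delta> * b2) * u (x, b2) - (\<gamma> + \<delta> * a2) * u (x, a2)" for x
  proof -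
    have "((\<lambda>y. ?Y (x, y)) has_integral ((\<gamma> + \<delta> * b2) * u (x, b2) - (\<gamma> + \<delta> * a2) * u (x, a2))) {a2..b2}"
      using ab by (intro fundamental_theorem_of_calculus)
        (auto simp flip: has_real_derivative_iff_has_vector_derivative intro!: derivative_eq_intros C1_partials[OF u])
    then show ?thesis by (rule integral_unique)
  qed
  have "integral ?C ?X = integral {a1..b1} (\<lambda>x. integral {a2..b2} (\<lambda>y. ?X (x, y)))"
    using integral_prod_continuous[OF cX, of a1 a2 b1 b2] by simp
  \<comment> \<open>\<open>?X\<close> is an exact derivative in x, so x must become the inner
    variable; for \<open>?Y\<close> the order is right already.\<close>
  also have "\<dots> = integral {a2..b2} (\<lambda>y. integral {a1..b1} (\<lambda>x. ?X (x, y)))"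
    using integral_swap_continuous[of a1 a2 b1 b2 "\<lambda>x y. ?X (x, y)"] cX by (simp add: case_prod_unfold)
  also have "\<dots> = (\<alpha> + \<beta> * b1) * integral {a2..b2} (\<lambda>y. u (b1, y)) - (\<alpha> + \<beta> * a1) * integral {a2..b2} (\<lambda>y. u (a1, y))"
    unfolding X1 using iu2 by (simp add: integral_diff integrable_on_mult_right)
  finally have X: "integral ?C ?X = \<dots>" .
  have "integral ?C ?Y = integral {a1..b1} (\<lambda>x. integral {a2..b2} (\<lambda>y. ?Y (x, y)))"
    using integral_prod_continuous[OF cY, of a1 a2 b1 b2] by simp
  also have "\<dots> = (\<gamma> + \<delta> * b2) * integral {a1..b1} (\<lambda>x. u (x, b2)) - (\<gamma> + \<delta> * a2) * integral {a1..b1} (\<lambda>x. u (x, a2))"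
    unfolding Y1 using iu1 by (simp add: integral_diff integrable_on_mult_right)
  finally have Y: "integral ?C ?Y = \<dots>" .
  have "integral ?C (\<lambda>z. grad u z \<bullet> rt_fun c z + u z * rt_div c) = integral ?C (\<lambda>z. ?X z + ?Y z)"
    by (rule integral_cong) (auto simp: c inner_prod_def algebra_simps)
  also have "\<dots> = integral ?C ?X + integral ?C ?Y"
    by (intro integral_add integrable_continuous cX cY)
  finally show ?thesis
    unfolding X Y K_def sum_cell_edges[OF ab]
    using ab by (simp add: edge_integral_horizontal edge_integral_vertical cu flux_def normal_comp_def c)
qed

subsection \<open>Smooth test functions\<close>

text \<open>One-variable counterpart of \<open>Ck\<close>. The test functions built below are
  products of functions of one variable, so their smoothness is checked at this level.\<close>

primrec Dk :: "nat \<Rightarrow> (real \<Rightarrow> real) \<Rightarrow> bool" where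
  "Dk 0 f \<longleftrightarrow> continuous_on UNIV f"
| "Dk (Suc k) f \<longleftrightarrow> (\<exists>f'. (\<forall>x. (f has_real_derivative f' x) (at x)) \<and> Dk k f')"

lemma Dk_SucD: "Dk (Suc k) f \<Longrightarrow> Dk k f"
proof (induction k arbitrary: f)
  case 0
  then show ?case by (auto intro: DERIV_continuous_on)
next
  case (Suc k)
  then obtain f' where "\<forall>x. (f has_real_derivative f' x) (at x)" "Dk (Suc k) f'"
    by (meson Dk.simps(2))
  then show ?case using Suc.IH by auto
qed

lemma Dk_add: "Dk k f \<Longrightarrow> Dk k g \<Longrightarrow> Dk k (\<lambda>x. f x + g x)"
proof (induction k arbitrary: f g)
  case 0
  then show ?case by (auto intro: continuous_intros)
next
  case (Suc k)
  then obtain f' g' where "\<forall>x. (f has_real_derivative f' x) (at x)" "Dk k f'"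
    "\<forall>x. (g has_real_derivative g' x) (at x)" "Dk k g'"
    by auto
  then show ?case using Suc.IH[of f' g']
    by (auto intro!: exI[of _ "\<lambda>x. f' x + g' x"] derivative_intros)
qed

lemma Dk_mult: "Dk k f \<Longrightarrow> Dk k g \<Longrightarrow> Dk k (\<lambda>x. f x * g x)"
proof (induction k arbitrary: f g)
  case 0
  then show ?case by (auto intro: continuous_intros)
next
  case (Suc k)
  then obtain f' g' where fg: "\<And>x. (f has_real_derivative f' x) (at x)" "Dk k f'"
    "\<And>x. (g has_real_derivative g' x) (at x)" "Dk k g'"
    by auto
  have "Dk k (\<lambda>x. f' x * g x + g' x * f x)"
    using Suc fg by (intro Dk_add Suc.IH Dk_SucD[of k f] Dk_SucD[of k g])
  then show ?case
    using DERIV_mult[OF fg(1) fg(3)]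
    by (auto intro!: exI[of _ "\<lambda>x. f' x * g x + g' x * f x"])
qed

lemma Dk_const: "Dk k (\<lambda>x. c)"
  by (induction k arbitrary: c) (auto intro!: exI[of _ "\<lambda>x. 0"])

lemma Dk_affine: "Dk k f \<Longrightarrow> Dk k (\<lambda>x. f (a + c * x))"
proof (induction k arbitrary: f)
  case 0
  have "continuous_on UNIV (\<lambda>x. a + c * x)" by (intro continuous_intros)
  from continuous_on_compose[OF this, of f] 0 show ?case
    using continuous_on_subset by (fastforce simp: o_def)
next
  case (Suc k)
  then obtain f' where f': "\<And>x. (f has_real_derivative f' x) (at x)" "Dk k f'"
    by auto
  have "((\<lambda>x. f (a + c * x)) has_real_derivative f' (a + c * x) * c) (at x)" for x
    by (rule DERIV_chain2[OF f'(1)]) (auto intro!: derivative_eq_intros)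
  moreover have "Dk k (\<lambda>x. f' (a + c * x) * c)"
    by (rule Dk_mult[OF Suc.IH[OF f'(2)] Dk_const])
  ultimately show ?case
    by (auto intro!: exI[of _ "\<lambda>x. f' (a + c * x) * c"])
qed

lemma Dk_continuous: "(\<And>k. Dk k f) \<Longrightarrow> continuous_on S f"
  by (metis Dk.simps(1) continuous_on_subset subset_UNIV)

lemma grad_eqI:
  assumes "(f has_derivative f') (at z)"
  shows "grad f z = (f' (1, 0), f' (0, 1))"
  using frechet_derivative_at[OF assms] by (simp add: grad_def)

text \<open>A partial derivative of f(x) g(y) is again such a product, with one factor
  differentiated, so the induction closes when \<open>f\<close> and \<open>g\<close> are
  arbitrary.\<close>

lemma Ck_product:
  "Dk k f \<Longrightarrow> Dk k g \<Longrightarrow> Ck k (\<lambda>z. f (fst z) * g (snd z))"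
proof (induction k arbitrary: f g)
  case 0
  then have "continuous_on UNIV (\<lambda>z::point. f (fst z))" "continuous_on UNIV (\<lambda>z::point. g (snd z))"
    by (auto intro!: continuous_on_compose2[of UNIV f] continuous_on_compose2[of UNIV g] continuous_intros)
  then show ?case by (auto intro: continuous_intros)
next
  case (Suc k)
  then obtain f' g' where fg: "\<And>x. (f has_real_derivative f' x) (at x)" "Dk k f'"
    "\<And>x. (g has_real_derivative g' x) (at x)" "Dk k g'"
    by auto
  have D: "((\<lambda>z. f (fst z) * g (snd z)) has_derivative
      (\<lambda>h. f' (fst z) * fst h * g (snd z) + f (fst z) * (g' (snd z) * snd h))) (at z)" for z :: point
    by (auto intro!: derivative_eq_intros has_derivative_compose[of fst, OF _ fg(1)[unfolded has_field_derivative_def]]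
        has_derivative_compose[of snd, OF _ fg(3)[unfolded has_field_derivative_def]] simp: fun_eq_iff)
  have "(\<lambda>z. f (fst z) * g (snd z)) differentiable_on UNIV"
    unfolding differentiable_on_def by (rule ballI) (simp add: differentiableI[OF D])
  moreover have "fst (grad (\<lambda>z. f (fst z) * g (snd z)) z) = f' (fst z) * g (snd z)"
    "snd (grad (\<lambda>z. f (fst z) * g (snd z)) z) = f (fst z) * g' (snd z)" for z
    by (simp_all add: grad_eqI[OF D])
  ultimately show ?case
    using Suc.IH fg Suc.prems by (simp add: Dk_SucD del: Dk.simps)
qed

lemma product_in_test_functions:
  assumes "\<And>k. Dk k f" "\<And>k. Dk k g"
    and "\<And>x. f x \<noteq> 0 \<Longrightarrow> p \<le> x \<and> x \<le> q" "\<And>y. g y \<noteq> 0 \<Longrightarrow> r \<le> y \<and> y \<le> s"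
    and sub: "cbox (p, r) (q, s) \<subseteq> \<Omega>"
  shows "(\<lambda>z. f (fst z) * g (snd z)) \<in> test_functions \<Omega>"
proof -
  let ?S = "closure {z. f (fst z) * g (snd z) \<noteq> 0}"
  have "{z. f (fst z) * g (snd z) \<noteq> 0} \<subseteq> cbox (p, r) (q, s)"
    using assms(3,4) by (auto simp: cbox_Pair_eq)
  then have S: "?S \<subseteq> cbox (p, r) (q, s)"
    by (rule closure_minimal) (rule closed_cbox)
  then have "compact ?S"
    by (meson bounded_cbox bounded_subset closed_closure compact_eq_bounded_closed)
  then show ?thesis
    using S sub assms(1,2) by (auto simp: test_functions_def Ck_product)
qed

lemma test_function_C1: "\<phi> \<in> test_functions \<Omega> \<Longrightarrow> C1 \<phi>"
proof -
  assume "\<phi> \<in> test_functions \<Omega>"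
  then have "Ck (Suc 0) \<phi>" unfolding test_functions_def by blast
  then have "\<phi> differentiable_on UNIV" "continuous_on UNIV (\<lambda>z. fst (grad \<phi> z))"
    "continuous_on UNIV (\<lambda>z. snd (grad \<phi> z))"
    by auto
  then show ?thesis using continuous_on_Pair[of UNIV "\<lambda>z. fst (grad \<phi> z)" "\<lambda>z. snd (grad \<phi> z)"]
    by (simp add: C1_def differentiable_on_def)
qed

text \<open>The family p(1/x) exp(-1/x), extended by zero, contains the classical flat function (p =
  1) and is closed under differentiation. Smoothness, also at 0, is then an induction with
  \<open>p\<close> arbitrary.\<close>

definition exp_poly :: "real poly \<Rightarrow> real \<Rightarrow> real" where
  "exp_poly p x = (if x > 0 then poly p (1 / x) * exp (- 1 / x) else 0)"

lemma poly_exp_tendsto_0: "((\<lambda>t. poly p t * exp (- t)) \<longlongrightarrow> 0) (at_top :: real filter)"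
proof -
  have "((\<lambda>t. \<Sum>i\<le>degree p. coeff p i * (t ^ i / exp t)) \<longlongrightarrow> (\<Sum>i\<le>degree p. coeff p i * 0)) at_top"
    by (intro tendsto_intros tendsto_power_div_exp_0)
  then show ?thesis
    by (simp add: poly_altdef sum_distrib_right exp_minus divide_inverse mult.assoc)
qed

text \<open>With t = 1/x the chain rule gives t^2 (p(t) - p'(t)) exp(-t) for positive x, and
  \<open>[:0, 0, 1:]\<close> is the polynomial t^2. At 0 the decay of the exponential makes the
  difference quotient vanish.\<close>

lemma exp_poly_DERIV:
  "(exp_poly p has_real_derivative exp_poly ([:0, 0, 1:] * (p - pderiv p)) x) (at x)"
proof -
  consider "x > 0" | "x < 0" | "x = 0" by linarith
  then show ?thesis
  proof cases
    case 1
    have "((\<lambda>x. poly p (1 / x) * exp (- 1 / x)) has_real_derivative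
        exp_poly ([:0, 0, 1:] * (p - pderiv p)) x) (at x)"
      using 1 by (auto intro!: derivative_eq_intros DERIV_chain2[OF poly_DERIV]
          simp: exp_poly_def field_simps power2_eq_square)
    then show ?thesis
      by (rule has_field_derivative_transform_within_open[where S="{0<..}"])
        (use 1 in \<open>auto simp: exp_poly_def\<close>)
  next
    case 2
    have "((\<lambda>x. 0) has_real_derivative 0) (at x)" by simp
    then have "(exp_poly p has_real_derivative 0) (at x)"
      by (rule has_field_derivative_transform_within_open[where S="{..<0}"])
        (use 2 in \<open>auto simp: exp_poly_def\<close>)
    then show ?thesis using 2 by (simp add: exp_poly_def)
  next
    case 3
    \<comment> \<open>With t = 1/h the right difference quotient at 0 equals t p(t) exp(-t), and
      \<open>pCons 0 p\<close> is the polynomial t p(t).\<close>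
    have "((\<lambda>t. poly (pCons 0 p) t * exp (- t)) \<longlongrightarrow> 0) at_top"
      by (rule poly_exp_tendsto_0)
    from filterlim_compose[OF this filterlim_inverse_at_top_right]
    have "((\<lambda>h. poly (pCons 0 p) (inverse h) * exp (- inverse h)) \<longlongrightarrow> 0) (at_right 0)" .
    then have R: "((\<lambda>h. (exp_poly p (0 + h) - exp_poly p 0) / h) \<longlongrightarrow> 0) (at_right 0)"
      by (rule Lim_transform_eventually)
        (auto simp: exp_poly_def eventually_at_right_field field_simps intro!: exI[of _ 1])
    have L: "((\<lambda>h. (exp_poly p (0 + h) - exp_poly p 0) / h) \<longlongrightarrow> 0) (at_left 0)"
      by (rule Lim_transform_eventually[OF tendsto_const])
        (auto simp: exp_poly_def eventually_at_left_field intro!: exI[of _ "-1"])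
    show ?thesis
      using L R 3 by (simp add: DERIV_def filterlim_split_at exp_poly_def)
  qed
qed

lemma Dk_exp_poly: "Dk k (exp_poly p)"
proof (induction k arbitrary: p)
  case 0
  show ?case
    unfolding Dk.simps by (rule DERIV_continuous_on) (rule exp_poly_DERIV)
next
  case (Suc k)
  show ?case
    unfolding Dk.simps
  proof (intro exI conjI allI)
    show "(exp_poly p has_real_derivative exp_poly ([:0, 0, 1:] * (p - pderiv p)) x) (at x)" for x
      by (rule exp_poly_DERIV)
    show "Dk k (exp_poly ([:0, 0, 1:] * (p - pderiv p)))"
      by (rule Suc.IH)
  qed
qed

section \<open>Smooth cut-off functions of one variable\<close>

definition ramp :: "real \<Rightarrow> real" where
  "ramp = exp_poly 1"

lemma Dk_ramp: "Dk k (\<lambda>x. ramp (a + c * x))"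
  unfolding ramp_def by (rule Dk_affine[OF Dk_exp_poly])

lemma ramp_pos_iff: "ramp x > 0 \<longleftrightarrow> x > 0"
  and ramp_eq_0_iff: "ramp x = 0 \<longleftrightarrow> x \<le> 0"
  and ramp_nonneg: "0 \<le> ramp x"
  and ramp_le_1: "ramp x \<le> 1"
  by (auto simp: ramp_def exp_poly_def)

lemma ramp_tendsto_1: "(ramp \<longlongrightarrow> 1) at_top"
proof -
  have "((\<lambda>x::real. exp (- 1 / x)) \<longlongrightarrow> exp 0) at_top"
    by (intro tendsto_intros tendsto_divide_0[OF tendsto_const] filterlim_at_top_imp_at_infinity filterlim_ident)
  then have "((\<lambda>x::real. exp (- 1 / x)) \<longlongrightarrow> 1) at_top"
    by simp
  then show ?thesis
    by (rule Lim_transform_eventually)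
      (auto simp: ramp_def exp_poly_def eventually_at_top_dense intro!: exI[of _ 0])
qed

text \<open>A smooth approximation of the indicator of the open interval from \<open>a\<close> to
  \<open>b\<close>. The shift by 1 keeps the support at distance 1/(n+1) from both ends, hence
  compactly inside; the growing factor drives both ramps to 1 at each inner point.\<close>

definition window :: "real \<Rightarrow> real \<Rightarrow> nat \<Rightarrow> real \<Rightarrow> real" where
  "window a b n x = ramp (real (Suc n) * (x - a) - 1) * ramp (real (Suc n) * (b - x) - 1)"

lemma Dk_window: "Dk k (window a b n)"
proof -
  have eq: "window a b n = (\<lambda>x. ramp ((- real (Suc n) * a - 1) + real (Suc n) * x) *
      ramp ((real (Suc n) * b - 1) + (- real (Suc n)) * x))"
    by (auto simp: window_def fun_eq_iff algebra_simps)
  show ?thesis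
    unfolding eq by (rule Dk_mult[OF Dk_ramp Dk_ramp])
qed

lemma window_bounds: "0 \<le> window a b n x" "window a b n x \<le> 1"
  by (auto simp: window_def ramp_nonneg ramp_le_1 mult_le_one)

lemma window_support:
  "window a b n x \<noteq> 0 \<Longrightarrow> a + 1 / real (Suc n) \<le> x \<and> x \<le> b - 1 / real (Suc n)"
  by (auto simp: window_def ramp_eq_0_iff field_simps)

lemma window_tendsto: "(\<lambda>n. window a b n x) \<longlonglongrightarrow> indicator {a<..<b} x"
proof (cases "x \<in> {a<..<b}")
  case True
  have lim: "(\<lambda>n. ramp (real (Suc n) * c - 1)) \<longlonglongrightarrow> 1" if "c > 0" for c
  proof (rule filterlim_compose[OF ramp_tendsto_1])
    have "filterlim (\<lambda>n. - 1 + c * real (Suc n)) at_top sequentially"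
      by (intro filterlim_tendsto_add_at_top[OF tendsto_const]
          filterlim_tendsto_pos_mult_at_top[OF tendsto_const that]
          filterlim_compose[OF filterlim_real_sequentially filterlim_Suc])
    then show "filterlim (\<lambda>n. real (Suc n) * c - 1) at_top sequentially"
      by (simp add: algebra_simps)
  qed
  have "(\<lambda>n. window a b n x) \<longlonglongrightarrow> 1 * 1"
    unfolding window_def using True by (intro tendsto_mult lim) auto
  then show ?thesis using True by simp
next
  case False
  have "window a b n x = 0" for n
  proof (rule ccontr)
    assume "window a b n x \<noteq> 0"
    from window_support[OF this] have "a < x \<and> x < b"
      using zero_less_divide_1_iff[of "real (Suc n)"] by linarith
    with False show "False" by simp
  qed
  then show ?thesis using False by simp
qed

text \<open>The profile across an edge: its support shrinks to the point \<open>a\<close>, while its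
  value there is the same positive number for all \<open>n\<close>. It thus disappears in area
  integrals but not in integrals along the edge.\<close>

definition spike :: "real \<Rightarrow> nat \<Rightarrow> real \<Rightarrow> real" where
  "spike a n x = ramp (1 - real (Suc n) * (x - a)) * ramp (1 + real (Suc n) * (x - a))"

lemma Dk_spike: "Dk k (spike a n)"
proof -
  have eq: "spike a n = (\<lambda>x. ramp ((1 + real (Suc n) * a) + (- real (Suc n)) * x) *
      ramp ((1 - real (Suc n) * a) + real (Suc n) * x))"
    by (auto simp: spike_def fun_eq_iff algebra_simps)
  show ?thesis
    unfolding eq by (rule Dk_mult[OF Dk_ramp Dk_ramp])
qed

lemma spike_bounds: "0 \<le> spike a n x" "spike a n x \<le> 1"
  by (auto simp: spike_def ramp_nonneg ramp_le_1 mult_le_one)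

lemma spike_support: "spike a n x \<noteq> 0 \<Longrightarrow> \<bar>x - a\<bar> < 1 / real (Suc n)"
  by (auto simp: spike_def ramp_eq_0_iff field_simps abs_if)

lemma spike_centre: "spike a n a = ramp 1 * ramp 1" "ramp 1 > 0"
  by (auto simp: spike_def ramp_pos_iff)

lemma spike_tendsto_0:
  assumes "x \<noteq> a" shows "(\<lambda>n. spike a n x) \<longlonglongrightarrow> 0"
proof -
  have "\<forall>\<^sub>F n in sequentially. 1 / real (Suc n) < \<bar>x - a\<bar>"
    using assms LIMSEQ_inverse_real_of_nat
    by (auto simp: order_tendsto_iff inverse_eq_divide)
  then have "\<forall>\<^sub>F n in sequentially. spike a n x = 0"
    by eventually_elim (use spike_support in fastforce)
  then show ?thesis by (simp add: tendsto_eventually)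
qed

text \<open>The profile along an edge, independent of \<open>n\<close> and complementary to
  \<open>spike\<close>.\<close>

definition hump :: "real \<Rightarrow> real \<Rightarrow> real \<Rightarrow> real" where
  "hump a b x = ramp (x - a) * ramp (b - x)"

lemma Dk_hump: "Dk k (hump a b)"
proof -
  have eq: "hump a b = (\<lambda>x. ramp (- a + 1 * x) * ramp (b + (- 1) * x))"
    by (auto simp: hump_def fun_eq_iff)
  show ?thesis
    unfolding eq by (rule Dk_mult[OF Dk_ramp Dk_ramp])
qed

lemma hump_bounds: "0 \<le> hump a b x" "hump a b x \<le> 1"
  by (auto simp: hump_def ramp_nonneg ramp_le_1 mult_le_one)

lemma hump_support: "hump a b x \<noteq> 0 \<longleftrightarrow> a < x \<and> x < b"
  by (auto simp: hump_def ramp_eq_0_iff)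

lemma hump_integral_pos:
  assumes "a < b" "c \<le> a" "b \<le> d"
  shows "integral {c..d} (hump a b) > 0"
proof -
  have cont: "continuous_on {c..d} (hump a b)"
    using Dk_hump by (rule Dk_continuous)
  have "integral {c..d} (hump a b) \<noteq> 0"
    using assms hump_support[of a b "(a + b) / 2"]
    by (subst integral_eq_0_iff[OF cont]) (auto simp: hump_bounds intro!: bexI[of _ "(a + b) / 2"])
  moreover have "integral {c..d} (hump a b) \<ge> 0"
    by (intro integral_nonneg integrable_continuous_real cont) (auto simp: hump_bounds)
  ultimately show ?thesis by linarith
qed

subsection \<open>Rectangular meshes\<close>

text \<open>Of two intervals with different indices, one ends no later than the other begins, so
  they share at most an end point, which the strict inequalities for \<open>i\<close> exclude. The
  weak ones for \<open>j\<close> fit a point known only to lie in a closed cell.\<close>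

lemma strict_mono_on_grid_locate:
  fixes x :: "nat \<Rightarrow> real"
  assumes x: "strict_mono_on {0..n} x" and "i \<in> {1..n}" "j \<in> {1..n}"
    and "x (i - 1) < s" "s < x i" "x (j - 1) \<le> s" "s \<le> x j"
  shows "i = j"
proof (rule ccontr)
  have le: "x k \<le> x l" if "k \<le> l" "l \<le> n" for k l
    using strict_mono_onD[OF x, of k l] that by (cases "k = l") auto
  assume "i \<noteq> j"
  then consider "i \<le> j - 1" | "j \<le> i - 1" by linarith
  then show False
  proof cases
    case 1
    then have "x i \<le> x (j - 1)" using assms(3) by (intro le) auto
    then show False using assms by linarith
  next
    case 2
    then have "x j \<le> x (i - 1)" using assms(2) by (intro le) auto
    then show False using assms by linarith
  qed
qed

lemma strict_mono_on_grid_le: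
  fixes x :: "nat \<Rightarrow> real"
  assumes "strict_mono_on {0..n} x" "k \<le> l" "l \<le> n"
  shows "x k \<le> x l"
  using strict_mono_onD[OF assms(1), of k l] assms by (cases "k = l") auto

lemma strict_mono_on_grid_eq:
  fixes x :: "nat \<Rightarrow> real"
  assumes "strict_mono_on {0..n} x" "k \<le> n" "l \<le> n" "x k = x l"
  shows "k = l"
  using strict_mono_on_imp_inj_on[OF assms(1)] assms by (auto dest: inj_onD)

text \<open>Used to push a point of \<Omega> off a grid line or vertex, into the open edge or to a
  chosen side of the edge.\<close>

lemma open_meets_interval:
  fixes S :: "real set"
  assumes "open S" "s \<in> S" "a \<le> s" "s \<le> b" "a < b"
  obtains t where "t \<in> S" "a < t" "t < b"
proof -
  have "s \<in> closure {a<..<b}" using assms by simp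
  then have "S \<inter> {a<..<b} \<noteq> {}"
    using open_Int_closure_eq_empty[OF assms(1), of "{a<..<b}"] assms(2) by auto
  then show thesis using that by auto
qed

lemma open_slices:
  fixes \<Omega> :: "point set"
  assumes "open \<Omega>"
  shows "open {s. (s, t) \<in> \<Omega>}" "open {t. (s, t) \<in> \<Omega>}"
proof -
  have "open ((\<lambda>s. (s, t)) -` \<Omega>)" "open ((\<lambda>t. (s, t)) -` \<Omega>)"
    by (intro open_vimage[OF assms] continuous_intros)+
  then show "open {s. (s, t) \<in> \<Omega>}" "open {t. (s, t) \<in> \<Omega>}"
    by (simp_all add: vimage_def)
qed

lemma mem_box_Pair: "(s, t) \<in> box (a, b) (c, d) \<longleftrightarrow> a < s \<and> s < c \<and> b < t \<and> t < (d::real)"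
  for a :: real
  by (auto simp: box_def Basis_prod_def)

definition cell_integral :: "cell \<Rightarrow> (point \<Rightarrow> 'b::euclidean_space) \<Rightarrow> 'b" where
  "cell_integral K f = integral (cbox (fst K) (snd K)) f"

locale rect_domain =
  fixes \<Omega> :: "point set" and x y :: "nat \<Rightarrow> real" and n1 n2 :: nat
  assumes open_domain: "open \<Omega>" and bounded_domain: "bounded \<Omega>"
    and rect_mesh: "rect_mesh \<Omega> n1 x n2 y"
begin

abbreviation T :: "cell set" where "T \<equiv> mesh \<Omega> n1 x n2 y"

definition cell :: "nat \<Rightarrow> nat \<Rightarrow> cell" where
  "cell i j = ((x (i - 1), y (j - 1)), (x i, y j))"

definition vert :: "nat \<Rightarrow> nat \<Rightarrow> edge" where
  "vert i j = ((x i, y (j - 1)), (x i, y j))"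

definition hori :: "nat \<Rightarrow> nat \<Rightarrow> edge" where
  "hori i j = ((x (i - 1), y j), (x i, y j))"

lemma mono_x: "strict_mono_on {0..n1} x" and mono_y: "strict_mono_on {0..n2} y"
  and Union_cells: "(\<Union>K\<in>T. cbox (fst K) (snd K)) = closure \<Omega>"
  and Union_boxes: "(\<Union>K\<in>T. box (fst K) (snd K)) \<subseteq> \<Omega>"
  using rect_mesh by (auto simp: rect_mesh_def case_prod_unfold)

lemma x_less: "k < l \<Longrightarrow> l \<le> n1 \<Longrightarrow> x k < x l"
  and y_less: "k < l \<Longrightarrow> l \<le> n2 \<Longrightarrow> y k < y l"
  using strict_mono_onD[OF mono_x, of k l] strict_mono_onD[OF mono_y, of k l] by auto

lemma mem_T_iff:
  "K \<in> T \<longleftrightarrow> (\<exists>i j. i \<in> {1..n1} \<and> j \<in> {1..n2} \<and> K = cell i j \<and> cbox (fst K) (snd K) \<subseteq> closure \<Omega>)"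
  unfolding mesh_def cell_def by force

lemma finite_T: "finite T"
proof (rule finite_subset)
  show "T \<subseteq> {cell i j | i j. i \<in> {1..n1} \<and> j \<in> {1..n2}}"
    using mem_T_iff by blast
  show "finite {cell i j | i j. i \<in> {1..n1} \<and> j \<in> {1..n2}}"
    by (rule finite_image_set2) auto
qed

lemma cell_shape:
  assumes "K \<in> T"
  obtains a1 a2 b1 b2 where "K = ((a1, a2), (b1, b2))" "a1 < b1" "a2 < b2"
  using assms by (auto simp: mem_T_iff cell_def intro!: x_less y_less that)

lemma box_subset: "K \<in> T \<Longrightarrow> box (fst K) (snd K) \<subseteq> \<Omega>"
  using Union_boxes by blast

lemma cbox_subset: "K \<in> T \<Longrightarrow> cbox (fst K) (snd K) \<subseteq> closure \<Omega>"
  by (auto simp: mem_T_iff)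

text \<open>The form with one open and one closed box yields both the disjointness of the open cells
  and the fact that closed cells overlap only in their boundaries.\<close>

lemma cell_unique:
  assumes "K \<in> T" "K' \<in> T" "z \<in> box (fst K) (snd K)" "z \<in> cbox (fst K') (snd K')"
  shows "K = K'"
proof -
  obtain i j i' j' where ij: "i \<in> {1..n1}" "j \<in> {1..n2}" "K = cell i j"
    "i' \<in> {1..n1}" "j' \<in> {1..n2}" "K' = cell i' j'"
    using assms(1,2) unfolding mem_T_iff by blast
  obtain s t where z: "z = (s, t)" by fastforce
  have "i = i'"
    using assms(3,4) ij z
    by (intro strict_mono_on_grid_locate[OF mono_x, of _ _ s]) (auto simp: cell_def mem_box_Pair cbox_Pair_eq)
  moreover have "j = j'"
    using assms(3,4) ij z
    by (intro strict_mono_on_grid_locate[OF mono_y, of _ _ t]) (auto simp: cell_def mem_box_Pair cbox_Pair_eq)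
  ultimately show ?thesis using ij by simp
qed

lemma negligible_skeleton: "negligible (\<Union>K\<in>T. cbox (fst K) (snd K) - box (fst K) (snd K))"
  using finite_T by (intro negligible_Union) (auto simp: negligible_frontier_interval)

lemma sets_domain: "\<Omega> \<in> sets lebesgue"
  using open_domain by auto

text \<open>The domain and the union of the closed cells differ by a part of the cell boundaries, a
  null set. So an integral over \<Omega> only sees the continuous functions \<open>g K\<close>,
  whatever \<open>f\<close> does on the boundaries of the cells.\<close>

lemma patch_integral:
  fixes f :: "point \<Rightarrow> 'b::euclidean_space"
  assumes g: "\<And>K. K \<in> T \<Longrightarrow> continuous_on (cbox (fst K) (snd K)) (g K)"
    and fg: "\<And>K z. K \<in> T \<Longrightarrow> z \<in> box (fst K) (snd K) \<Longrightarrow> f z = g K z"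
  shows "integrable (lebesgue_on \<Omega>) f"
    and "(LINT z|lebesgue_on \<Omega>. f z) = (\<Sum>K\<in>T. cell_integral K (g K))"
proof -
  let ?C = "\<lambda>K::cell. cbox (fst K) (snd K)" and ?B = "\<lambda>K::cell. box (fst K) (snd K)"
  \<comment> \<open>The first difference lies in the skeleton because the open cells are contained
    in \<Omega>; the second is empty because the closed cells fill the closure.\<close>
  have neg: "negligible (\<Union> (?C ` T) - \<Omega>)" "\<Omega> - \<Union> (?C ` T) = {}"
    using box_subset Union_cells closure_subset[of \<Omega>]
    by (blast intro: negligible_subset[OF negligible_skeleton])+
  have fC: "f absolutely_integrable_on ?C K" if "K \<in> T" for K
    by (rule absolutely_integrable_spike[OF absolutely_integrable_continuous[OF g[OF that]]
          negligible_frontier_interval]) (use fg[OF that] in blast)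
  have "f absolutely_integrable_on (\<Union> (?C ` S))" if "S \<subseteq> T" for S
    using finite_subset[OF that finite_T] that
  proof (induction S rule: finite_induct)
    case (insert K S)
    then show ?case using fC[of K] absolutely_integrable_Un by auto
  qed auto
  then have "f absolutely_integrable_on (\<Union> (?C ` T))" by simp
  then have "f absolutely_integrable_on \<Omega>"
    using neg by (subst absolutely_integrable_spike_set_eq[of _ "\<Union> (?C ` T)"])
      (auto intro: negligible_subset[OF neg(1)])
  then show int: "integrable (lebesgue_on \<Omega>) f"
    using absolutely_integrable_imp_integrable sets_domain by blast
  have "(f has_integral cell_integral K (g K)) (?C K)" if "K \<in> T" for K
  proof -
    have "(g K has_integral cell_integral K (g K)) (?C K)"
      unfolding cell_integral_def by (intro integrable_integral integrable_continuous g that)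
    then show ?thesis
      by (rule has_integral_spike[OF negligible_frontier_interval, rotated]) (use fg[OF that] in blast)
  qed
  moreover have "pairwise (\<lambda>K K'. negligible (?C K \<inter> ?C K')) T"
  proof (rule pairwiseI)
    fix K K' assume K: "K \<in> T" "K' \<in> T" "K \<noteq> K'"
    have "?C K \<inter> ?C K' \<subseteq> (\<Union>K\<in>T. ?C K - ?B K)"
      using cell_unique[OF K(1,2)] K by auto
    then show "negligible (?C K \<inter> ?C K')" by (rule negligible_subset[OF negligible_skeleton])
  qed
  ultimately have "(f has_integral (\<Sum>K\<in>T. cell_integral K (g K))) (\<Union> (?C ` T))"
    by (intro has_integral_UN finite_T)
  then have "(f has_integral (\<Sum>K\<in>T. cell_integral K (g K))) \<Omega>"
    using neg by (subst has_integral_spike_set_eq[of _ "\<Union> (?C ` T)"])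
      (auto intro: negligible_subset[OF neg(1)])
  then show "(LINT z|lebesgue_on \<Omega>. f z) = (\<Sum>K\<in>T. cell_integral K (g K))"
    using lebesgue_integral_eq_integral[OF int sets_domain] by (simp add: integral_unique)
qed

text \<open>Continuity on the whole plane is available for polynomials and test functions alike and
  spares extensions from the open to the closed cell.\<close>

definition patch :: "(point \<Rightarrow> 'b::euclidean_space) \<Rightarrow> (cell \<Rightarrow> point \<Rightarrow> 'b) \<Rightarrow> bool" where
  "patch f g \<longleftrightarrow> (\<forall>K\<in>T. continuous_on UNIV (g K) \<and> (\<forall>z\<in>box (fst K) (snd K). f z = g K z))"

lemma patch_L2: "patch f g \<Longrightarrow> f \<in> L2 \<Omega>"
proof -
  assume "patch f g"
  then have c: "\<And>K S. K \<in> T \<Longrightarrow> continuous_on S (g K)" and eq: "\<And>K z. K \<in> T \<Longrightarrow> z \<in> box (fst K) (snd K) \<Longrightarrow> f z = g K z"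
    unfolding patch_def using continuous_on_subset by blast+
  have "integrable (lebesgue_on \<Omega>) f"
    by (rule patch_integral(1)[where g=g]) (use c eq in auto)
  moreover have "integrable (lebesgue_on \<Omega>) (\<lambda>z. (norm (f z))\<^sup>2)"
    by (rule patch_integral(1)[where g="\<lambda>K z. (norm (g K z))\<^sup>2"]) (use c eq in \<open>auto intro!: continuous_intros\<close>)
  ultimately show ?thesis
    by (simp add: L2_def borel_measurable_integrable)
qed

lemma l2_inner_patch:
  assumes "patch f g" "patch f' g'"
  shows "l2_inner \<Omega> f f' = (\<Sum>K\<in>T. cell_integral K (\<lambda>z. g K z \<bullet> g' K z))"
  unfolding l2_inner_def
proof (rule patch_integral(2))
  fix K assume "K \<in> T"
  then show "continuous_on (cbox (fst K) (snd K)) (\<lambda>z. g K z \<bullet> g' K z)"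
    using assms unfolding patch_def by (auto intro!: continuous_intros intro: continuous_on_subset)
qed (use assms in \<open>auto simp: patch_def\<close>)

section \<open>Edges of the grid and their neighbouring cells\<close>

lemma cell_edges_cell:
  "cell_edges (cell i j) = {hori i (j - 1), hori i j, vert (i - 1) j, vert i j}"
  by (simp add: cell_def hori_def vert_def)

lemma vert_neq_hori: "i \<in> {1..n1} \<Longrightarrow> vert k l \<noteq> hori i j"
  using x_less[of "i - 1" i] by (auto simp: vert_def hori_def)

lemma vert_eqD: "vert i j = vert k l \<Longrightarrow> i \<le> n1 \<Longrightarrow> k \<le> n1 \<Longrightarrow> j \<le> n2 \<Longrightarrow> l \<le> n2 \<Longrightarrow> i = k \<and> j = l"
  using strict_mono_on_grid_eq[OF mono_x, of i k] strict_mono_on_grid_eq[OF mono_y, of j l]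
  by (auto simp: vert_def)

lemma hori_eqD: "hori i j = hori k l \<Longrightarrow> i \<le> n1 \<Longrightarrow> k \<le> n1 \<Longrightarrow> j \<le> n2 \<Longrightarrow> l \<le> n2 \<Longrightarrow> i = k \<and> j = l"
  using strict_mono_on_grid_eq[OF mono_x, of i k] strict_mono_on_grid_eq[OF mono_y, of j l]
  by (auto simp: hori_def)

lemma mesh_edge_cases:
  assumes "e \<in> mesh_edges T"
  obtains (vert) i j where "e = vert i j" "i \<le> n1" "j \<in> {1..n2}"
  | (hori) i j where "e = hori i j" "i \<in> {1..n1}" "j \<le> n2"
proof -
  obtain K where K: "K \<in> T" "e \<in> cell_edges K"
    using assms by (auto simp: mesh_edges_def simp del: split_paired_All)
  then obtain i j where "i \<in> {1..n1}" "j \<in> {1..n2}" "e \<in> cell_edges (cell i j)"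
    unfolding mem_T_iff by blast
  then show thesis
    unfolding cell_edges_cell using vert[of "i - 1" j] vert[of i j] hori[of i "j - 1"] hori[of i j]
    by auto
qed

lemma segment_vert: "j \<in> {1..n2} \<Longrightarrow> closed_segment (fst (vert i j)) (snd (vert i j)) = {x i} \<times> {y (j - 1)..y j}"
  using y_less[of "j - 1" j] by (auto simp: vert_def closed_segment_same_fst closed_segment_eq_real_ivl)

lemma segment_hori: "i \<in> {1..n1} \<Longrightarrow> closed_segment (fst (hori i j)) (snd (hori i j)) = {x (i - 1)..x i} \<times> {y j}"
  using x_less[of "i - 1" i] by (auto simp: hori_def closed_segment_same_snd closed_segment_eq_real_ivl)

lemma edge_subset_cbox:
  assumes "K \<in> T" "e \<in> cell_edges K"
  shows "closed_segment (fst e) (snd e) \<subseteq> cbox (fst K) (snd K)"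
proof -
  obtain i j where ij: "i \<in> {1..n1}" "j \<in> {1..n2}" "K = cell i j"
    using assms by (auto simp: mem_T_iff)
  have "x (i - 1) < x i" "y (j - 1) < y j" using ij by (auto intro!: x_less y_less)
  then show ?thesis
    using assms(2) ij segment_vert[of j] segment_hori[of i] unfolding ij(3) cell_edges_cell
    by (auto simp: cell_def cbox_Pair_eq)
qed

text \<open>An edge lies in \<open>closure \<Omega>\<close>, and the closure of an open set without
  its frontier is the set itself.\<close>

lemma edge_meets_domain:
  assumes "e \<in> mesh_edges T" "\<not> closed_segment (fst e) (snd e) \<subseteq> frontier \<Omega>"
  obtains z where "z \<in> closed_segment (fst e) (snd e)" "z \<in> \<Omega>"
proof -
  obtain z where z: "z \<in> closed_segment (fst e) (snd e)" "z \<notin> frontier \<Omega>"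
    using assms(2) by blast
  have "z \<in> closure \<Omega>"
    using assms(1) z edge_subset_cbox cbox_subset unfolding mesh_edges_def by blast
  then show thesis
    using that z open_domain by (auto simp: frontier_def interior_open)
qed

lemma mem_domain_cell:
  assumes "(s, t) \<in> \<Omega>"
  obtains i j where "i \<in> {1..n1}" "j \<in> {1..n2}" "cell i j \<in> T"
    "x (i - 1) \<le> s" "s \<le> x i" "y (j - 1) \<le> t" "t \<le> y j"
proof -
  have "(s, t) \<in> (\<Union>K\<in>T. cbox (fst K) (snd K))"
    using assms closure_subset Union_cells by blast
  then obtain K where K: "K \<in> T" "(s, t) \<in> cbox (fst K) (snd K)" by blast
  then obtain i j where "i \<in> {1..n1}" "j \<in> {1..n2}" "K = cell i j"
    unfolding mem_T_iff by blast
  then show thesis using K by (intro that[of i j]) (auto simp: cell_def cbox_Pair_eq)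
qed

text \<open>A point of \<Omega> on the edge can be moved by openness into the relative interior of
  the edge, and from there a little to the left and to the right. The moved points still lie in
  closed cells of the mesh, which must be the two neighbours of the edge.\<close>

lemma vert_interior:
  assumes e: "vert i j \<in> mesh_edges T" "i \<le> n1" "j \<in> {1..n2}"
    and nf: "\<not> closed_segment (fst (vert i j)) (snd (vert i j)) \<subseteq> frontier \<Omega>"
  obtains t where "y (j - 1) < t" "t < y j" "(x i, t) \<in> \<Omega>" "1 \<le> i" "i < n1"
    "cell i j \<in> T" "cell (Suc i) j \<in> T"
proof -
  have yj: "y (j - 1) < y j" using e by (auto intro: y_less)
  obtain s0 where "(x i, s0) \<in> \<Omega>" "y (j - 1) \<le> s0" "s0 \<le> y j"
    by (rule edge_meets_domain[OF e(1) nf]) (auto simp: segment_vert[OF e(3)])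
  then obtain t where t: "(x i, t) \<in> \<Omega>" "y (j - 1) < t" "t < y j"
    using open_meets_interval[OF open_slices(2)[OF open_domain], of s0 "x i" "y (j - 1)" "y j"] yj by auto
  have ox: "open {s. (s, t) \<in> \<Omega>}" by (rule open_slices(1)[OF open_domain])
  \<comment> \<open>As \<open>t\<close> lies strictly between two grid lines, every closed cell
    covering a point of \<Omega> at height \<open>t\<close> belongs to row \<open>j\<close>.\<close>
  have col: "\<exists>i'\<in>{1..n1}. x (i' - 1) \<le> s \<and> s \<le> x i' \<and> cell i' j \<in> T" if st: "(s, t) \<in> \<Omega>" for s
  proof -
    obtain i' j' where ij: "i' \<in> {1..n1}" "j' \<in> {1..n2}" "cell i' j' \<in> T"
      "x (i' - 1) \<le> s" "s \<le> x i'" "y (j' - 1) \<le> t" "t \<le> y j'"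
      using mem_domain_cell[OF st] by metis
    with strict_mono_on_grid_locate[OF mono_y e(3) ij(2) t(2,3)] show ?thesis by blast
  qed
  \<comment> \<open>The outermost grid lines are excluded first: a point of \<Omega> beyond them
    would lie in no cell. In particular \<open>i - 1\<close> is then a genuine predecessor.\<close>
  have "i \<noteq> 0"
  proof
    assume "i = 0"
    obtain s where s: "(s, t) \<in> \<Omega>" "s < x i"
      using open_meets_interval[OF ox, of "x i" "x i - 1" "x i"] t(1) by auto
    then obtain i' where "i' \<in> {1..n1}" "x (i' - 1) \<le> s" using col by blast
    moreover from this have "i' - 1 \<le> n1" by (simp add: le_diff_conv)
    ultimately show False using strict_mono_on_grid_le[OF mono_x, of 0 "i' - 1"] s \<open>i = 0\<close> by simp
  qed
  moreover have "i \<noteq> n1"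
  proof
    assume "i = n1"
    obtain s where s: "(s, t) \<in> \<Omega>" "x i < s"
      using open_meets_interval[OF ox, of "x i" "x i" "x i + 1"] t(1) by auto
    then obtain i' where "i' \<in> {1..n1}" "s \<le> x i'" using col by blast
    then show False using strict_mono_on_grid_le[OF mono_x, of "i'" n1] s \<open>i = n1\<close> by auto
  qed
  ultimately have i: "1 \<le> i" "i < n1" using e by auto
  obtain s where s: "(s, t) \<in> \<Omega>" "x (i - 1) < s" "s < x i"
    using open_meets_interval[OF ox, of "x i" "x (i - 1)" "x i"] t(1) x_less[of "i - 1" i] i by auto
  obtain i' where i': "i' \<in> {1..n1}" "x (i' - 1) \<le> s" "s \<le> x i'" "cell i' j \<in> T" using col[OF s(1)] by blast
  then have 1: "cell i j \<in> T"
    using strict_mono_on_grid_locate[OF mono_x _ i'(1) s(2,3)] i by auto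
  obtain s where s: "(s, t) \<in> \<Omega>" "x i < s" "s < x (Suc i)"
    using open_meets_interval[OF ox, of "x i" "x i" "x (Suc i)"] t(1) x_less[of i "Suc i"] i by auto
  obtain i' where i': "i' \<in> {1..n1}" "x (i' - 1) \<le> s" "s \<le> x i'" "cell i' j \<in> T" using col[OF s(1)] by blast
  then have 2: "cell (Suc i) j \<in> T"
    using strict_mono_on_grid_locate[OF mono_x, of "Suc i" i' s] i s by auto
  show thesis using that t i 1 2 by blast
qed

text \<open>The argument of \<open>vert_interior\<close> with the coordinates exchanged.\<close>

lemma hori_interior:
  assumes e: "hori i j \<in> mesh_edges T" "i \<in> {1..n1}" "j \<le> n2"
    and nf: "\<not> closed_segment (fst (hori i j)) (snd (hori i j)) \<subseteq> frontier \<Omega>"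
  obtains s where "x (i - 1) < s" "s < x i" "(s, y j) \<in> \<Omega>" "1 \<le> j" "j < n2"
    "cell i j \<in> T" "cell i (Suc j) \<in> T"
proof -
  have xi: "x (i - 1) < x i" using e by (auto intro: x_less)
  obtain s0 where "(s0, y j) \<in> \<Omega>" "x (i - 1) \<le> s0" "s0 \<le> x i"
    by (rule edge_meets_domain[OF e(1) nf]) (auto simp: segment_hori[OF e(2)])
  then obtain s where s: "(s, y j) \<in> \<Omega>" "x (i - 1) < s" "s < x i"
    using open_meets_interval[OF open_slices(1)[OF open_domain], of s0 "y j" "x (i - 1)" "x i"] xi by auto
  have oy: "open {t. (s, t) \<in> \<Omega>}" by (rule open_slices(2)[OF open_domain])
  have row: "\<exists>j'\<in>{1..n2}. y (j' - 1) \<le> t \<and> t \<le> y j' \<and> cell i j' \<in> T" if st: "(s, t) \<in> \<Omega>" for t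
  proof -
    obtain i' j' where ij: "i' \<in> {1..n1}" "j' \<in> {1..n2}" "cell i' j' \<in> T"
      "x (i' - 1) \<le> s" "s \<le> x i'" "y (j' - 1) \<le> t" "t \<le> y j'"
      using mem_domain_cell[OF st] by metis
    with strict_mono_on_grid_locate[OF mono_x e(2) ij(1) s(2,3)] show ?thesis by blast
  qed
  have "j \<noteq> 0"
  proof
    assume "j = 0"
    obtain t where t: "(s, t) \<in> \<Omega>" "t < y j"
      using open_meets_interval[OF oy, of "y j" "y j - 1" "y j"] s(1) by auto
    then obtain j' where "j' \<in> {1..n2}" "y (j' - 1) \<le> t" using row by blast
    moreover from this have "j' - 1 \<le> n2" by (simp add: le_diff_conv)
    ultimately show False using strict_mono_on_grid_le[OF mono_y, of 0 "j' - 1"] t \<open>j = 0\<close> by simp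
  qed
  moreover have "j \<noteq> n2"
  proof
    assume "j = n2"
    obtain t where t: "(s, t) \<in> \<Omega>" "y j < t"
      using open_meets_interval[OF oy, of "y j" "y j" "y j + 1"] s(1) by auto
    then obtain j' where "j' \<in> {1..n2}" "t \<le> y j'" using row by blast
    then show False using strict_mono_on_grid_le[OF mono_y, of "j'" n2] t \<open>j = n2\<close> by auto
  qed
  ultimately have j: "1 \<le> j" "j < n2" using e by auto
  obtain t where t: "(s, t) \<in> \<Omega>" "y (j - 1) < t" "t < y j"
    using open_meets_interval[OF oy, of "y j" "y (j - 1)" "y j"] s(1) y_less[of "j - 1" j] j by auto
  obtain j' where j': "j' \<in> {1..n2}" "y (j' - 1) \<le> t" "t \<le> y j'" "cell i j' \<in> T" using row[OF t(1)] by blast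
  then have 1: "cell i j \<in> T"
    using strict_mono_on_grid_locate[OF mono_y _ j'(1) t(2,3)] j by auto
  obtain t where t: "(s, t) \<in> \<Omega>" "y j < t" "t < y (Suc j)"
    using open_meets_interval[OF oy, of "y j" "y j" "y (Suc j)"] s(1) y_less[of j "Suc j"] j by auto
  obtain j' where j': "j' \<in> {1..n2}" "y (j' - 1) \<le> t" "t \<le> y j'" "cell i j' \<in> T" using row[OF t(1)] by blast
  then have 2: "cell i (Suc j) \<in> T"
    using strict_mono_on_grid_locate[OF mono_y, of "Suc j" j' t] j t by auto
  show thesis using that s j 1 2 by blast
qed

text \<open>Follows the case distinction in \<open>jumps\<close>: an edge lying only partly in the
  frontier counts as interior, an edge of a slit does not, even with cells on both sides.\<close>

definition interior_edge :: "edge \<Rightarrow> bool" where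
  "interior_edge e \<longleftrightarrow> e \<in> mesh_edges T \<and> \<not> closed_segment (fst e) (snd e) \<subseteq> frontier \<Omega>"

text \<open>Injectivity of the grid recovers the indices of the edge, which leaves only its two
  neighbours; it is the right or upper edge of \<open>K\<close> and the left or lower edge of
  \<open>K'\<close>.\<close>

lemma interior_edge_cells:
  assumes "interior_edge e"
  obtains K K' where "K \<noteq> K'" "{K \<in> T. e \<in> cell_edges K} = {K, K'}" "osign K e = 1" "osign K' e = - 1"
proof -
  from assms have e: "e \<in> mesh_edges T" and nf: "\<not> closed_segment (fst e) (snd e) \<subseteq> frontier \<Omega>"
    by (auto simp: interior_edge_def)
  from e show thesis
  proof (cases rule: mesh_edge_cases)
    case (vert i j)
    obtain i1: "1 \<le> i" "i < n1" and c: "cell i j \<in> T" "cell (Suc i) j \<in> T"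
      using vert_interior[of i j] e nf vert by metis
    have x: "x (i - 1) < x i" "x i < x (Suc i)" using i1 by (auto intro: x_less)
    have "K = cell i j \<or> K = cell (Suc i) j" if K: "K \<in> T" "vert i j \<in> cell_edges K" for K
    proof -
      obtain k l where kl: "k \<in> {1..n1}" "l \<in> {1..n2}" "K = cell k l"
        using K by (auto simp: mem_T_iff)
      then have "vert i j = vert (k - 1) l \<or> vert i j = vert k l"
        using K(2) vert_neq_hori[OF kl(1)] unfolding kl(3) cell_edges_cell by auto
      then have "(k = Suc i \<or> k = i) \<and> l = j"
        using vert_eqD[of i j "k - 1" l] vert_eqD[of i j k l] vert kl(1,2) by auto
      then show ?thesis using kl by auto
    qed
    then have "{K \<in> T. e \<in> cell_edges K} = {cell i j, cell (Suc i) j}"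
      using c vert by (auto simp: cell_edges_cell)
    moreover have "osign (cell i j) e = 1" "osign (cell (Suc i) j) e = - 1" "cell i j \<noteq> cell (Suc i) j"
      using x vert by (auto simp: osign_def cell_def vert_def)
    ultimately show thesis using that by blast
  next
    case (hori i j)
    obtain j1: "1 \<le> j" "j < n2" and c: "cell i j \<in> T" "cell i (Suc j) \<in> T"
      using hori_interior[of i j] e nf hori by metis
    have y: "y (j - 1) < y j" "y j < y (Suc j)" using j1 by (auto intro: y_less)
    have "K = cell i j \<or> K = cell i (Suc j)" if K: "K \<in> T" "hori i j \<in> cell_edges K" for K
    proof -
      obtain k l where kl: "k \<in> {1..n1}" "l \<in> {1..n2}" "K = cell k l"
        using K by (auto simp: mem_T_iff)
      then have "hori i j = hori k (l - 1) \<or> hori i j = hori k l"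
        using K(2) vert_neq_hori[OF hori(2)] unfolding kl(3) cell_edges_cell by (metis empty_iff insert_iff)
      then have "(l = Suc j \<or> l = j) \<and> k = i"
        using hori_eqD[of i j k "l - 1"] hori_eqD[of i j k l] hori kl(1,2) by auto
      then show ?thesis using kl by auto
    qed
    then have "{K \<in> T. e \<in> cell_edges K} = {cell i j, cell i (Suc j)}"
      using c hori by (auto simp: cell_edges_cell)
    moreover have "osign (cell i j) e = 1" "osign (cell i (Suc j)) e = - 1" "cell i j \<noteq> cell i (Suc j)"
      using y hori by (auto simp: osign_def cell_def hori_def)
    ultimately show thesis using that by blast
  qed
qed

end

subsection \<open>Shape functions and degrees of freedom\<close>

text \<open>Cells and edges are nested pairs; the simplifier would otherwise break quantified cells
  and edges into coordinates.\<close>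

declare split_paired_All [simp del] split_paired_Ex [simp del]

lemma QxQ_eq_range: "QxQ = range rt_fun"
proof
  have 10: "(\<lambda>(x, y). \<Sum>i\<le>1. \<Sum>j\<le>0. c i j * x ^ i * y ^ j) = (\<lambda>(x, y). c 0 0 + c 1 0 * x)"
    and 01: "(\<lambda>(x, y). \<Sum>i\<le>0. \<Sum>j\<le>1. c i j * x ^ i * y ^ j) = (\<lambda>(x, y). c 0 0 + c 0 1 * y)"
    for c :: "nat \<Rightarrow> nat \<Rightarrow> real"
    by (auto simp: fun_eq_iff)
  show "QxQ \<subseteq> range rt_fun"
  proof
    fix \<tau> assume "\<tau> \<in> QxQ"
    then obtain c d where "\<tau> = (\<lambda>z. ((\<lambda>(x, y). \<Sum>i\<le>1. \<Sum>j\<le>0. c i j * x ^ i * y ^ j) z,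
        (\<lambda>(x, y). \<Sum>i\<le>0. \<Sum>j\<le>1. d i j * x ^ i * y ^ j) z))"
      unfolding QxQ_def Q_def by blast
    then have "\<tau> = rt_fun (c 0 0, c 1 0, d 0 0, d 0 1)"
      unfolding 10 01 by auto
    then show "\<tau> \<in> range rt_fun" by blast
  qed
  show "range rt_fun \<subseteq> QxQ"
  proof
    fix \<tau> assume "\<tau> \<in> range rt_fun"
    then obtain a b c d where \<tau>: "\<tau> = rt_fun (a, b, c, d)" by auto
    have "(\<lambda>(x, y). a + b * x) \<in> Q 1 0" "(\<lambda>(x, y). c + d * y) \<in> Q 0 1"
      using 10[of "\<lambda>i j. if i = 0 then a else b", symmetric] 01[of "\<lambda>i j. if j = 0 then c else d", symmetric]
      unfolding Q_def by (auto intro!: exI simp del: One_nat_def)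
    moreover have "\<tau> = (\<lambda>z. ((\<lambda>(x, y). a + b * x) z, (\<lambda>(x, y). c + d * y) z))"
      by (auto simp: \<tau>)
    ultimately show "\<tau> \<in> QxQ" unfolding QxQ_def by blast
  qed
qed

lemma rt_fun_uminus: "rt_fun (- c) z = - rt_fun c z" "rt_div (- c) = - rt_div c" "flux (- c) e = - flux c e"
proof -
  obtain a b d e' where c: "c = (a, b, d, e')" by (metis prod_cases4)
  show "rt_fun (- c) z = - rt_fun c z" for z by (cases z) (simp add: c)
  then show "flux (- c) e = - flux c e" by (simp add: flux_def normal_comp_def)
  show "rt_div (- c) = - rt_div c" by (simp add: c)
qed

lemma rt_fun_eq_on_box:
  assumes "a1 < b1" "a2 < b2" "\<And>z. z \<in> box (a1, a2) (b1, b2) \<Longrightarrow> rt_fun c z = rt_fun c' z"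
  shows "c = c'"
proof -
  obtain s s' t t' where st: "a1 < s" "s < s'" "s' < b1" "a2 < t" "t < t'" "t' < b2"
    using dense[OF assms(1)] dense[OF assms(2)] dense by metis
  obtain p q r u where c: "c = (p, q, r, u)" by (metis prod_cases4)
  obtain p' q' r' u' where c': "c' = (p', q', r', u')" by (metis prod_cases4)
  have eq: "p + q * s = p' + q' * s" "p + q * s' = p' + q' * s'"
    "r + u * t = r' + u' * t" "r + u * t' = r' + u' * t'"
    using assms(3)[of "(s, t)"] assms(3)[of "(s', t')"] st by (auto simp: mem_box_Pair c c')
  have "(q - q') * (s' - s) = 0" "(u - u') * (t' - t) = 0"
    using eq by (auto simp: algebra_simps)
  then have "q = q'" "u = u'" using st by auto
  then show ?thesis using eq c c' by simp
qed

lemma EQ_shape_has_derivative: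
  "((\<lambda>(x, y). a + b * x + c * y + d * x\<^sup>2 + e * y\<^sup>2) has_derivative
     (\<lambda>h. (b + 2 * d * fst z) * fst h + (c + 2 * e * snd z) * snd h)) (at (z :: point))"
  unfolding case_prod_unfold
  by (auto intro!: derivative_eq_intros simp: fun_eq_iff algebra_simps)

lemma EQ_shape_C1: "p \<in> EQ_shape \<Longrightarrow> C1 p"
  and EQ_shape_grad: "p \<in> EQ_shape \<Longrightarrow> \<exists>c. grad p = rt_fun c"
proof -
  assume "p \<in> EQ_shape"
  then obtain a b c d e where p: "p = (\<lambda>(x, y). a + b * x + c * y + d * x\<^sup>2 + e * y\<^sup>2)"
    unfolding EQ_shape_def by blast
  have g: "grad p = rt_fun (b, 2 * d, c, 2 * e)"
    unfolding p by (auto simp: grad_eqI[OF EQ_shape_has_derivative])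
  then show "\<exists>c. grad p = rt_fun c" by blast
  show "C1 p"
    unfolding C1_def g using EQ_shape_has_derivative[THEN differentiableI] unfolding p
    by (simp add: continuous_on_rt_fun)
qed

lemma C1_eq_of_grad_eq:
  assumes "C1 p" "C1 q" "grad p = grad q"
  shows "\<exists>k. \<forall>z. p z = q z + k"
proof -
  have D: "(f has_derivative (\<lambda>h. grad f z \<bullet> h)) (at z)" if "C1 f" for f z
  proof -
    let ?D = "frechet_derivative f (at z)"
    have D: "(f has_derivative ?D) (at z)"
      using that by (simp add: C1_def frechet_derivative_works)
    then have lin: "linear ?D" by (rule has_derivative_linear)
    have "?D h = grad f z \<bullet> h" for h
    proof -
      have "?D (fst h *\<^sub>R (1, 0) + snd h *\<^sub>R (0, 1)) = fst h * ?D (1, 0) + snd h * ?D (0, 1)"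
        unfolding linear_add[OF lin] linear_scale[OF lin] by simp
      then show ?thesis by (simp add: grad_def inner_prod_def mult.commute)
    qed
    then have "?D = (\<lambda>h. grad f z \<bullet> h)" by blast
    with D show ?thesis by simp
  qed
  have "((\<lambda>z. p z - q z) has_derivative (\<lambda>h. 0)) (at z)" for z
    using has_derivative_diff[OF D[OF assms(1)] D[OF assms(2)], of z] assms(3) by simp
  then have "\<exists>k. \<forall>z\<in>UNIV. p z - q z = k"
    by (intro has_derivative_zero_constant) auto
  then show ?thesis by (auto simp: algebra_simps)
qed

text \<open>The number (b - a)^2 / 12 is the mean of the squared distance to the midpoint, so the
  linear and the quadratic term both have mean zero.\<close>

lemma integral_quadratic_centred:
  fixes a b :: real
  assumes "a < b"
  shows "integral {a..b} (\<lambda>t. \<alpha> + \<beta> * (t - (a + b) / 2) + \<gamma> * ((t - (a + b) / 2)\<^sup>2 - (b - a)\<^sup>2 / 12)) = \<alpha> * (b - a)"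
proof -
  let ?m = "(a + b) / 2"
  let ?F = "\<lambda>t. \<alpha> * t + \<beta> * (t - ?m)\<^sup>2 / 2 + \<gamma> * ((t - ?m) ^ 3 / 3 - (b - a)\<^sup>2 / 12 * t)"
  have I: "((\<lambda>t. \<alpha> + \<beta> * (t - ?m) + \<gamma> * ((t - ?m)\<^sup>2 - (b - a)\<^sup>2 / 12)) has_integral ?F b - ?F a) {a..b}"
    using assms by (intro fundamental_theorem_of_calculus)
      (auto simp flip: has_real_derivative_iff_has_vector_derivative intro!: derivative_eq_intros)
  have eq: "?F b - ?F a = \<alpha> * (b - a)"
    by (simp add: field_simps power2_eq_square power3_eq_cube)
  show ?thesis by (rule integral_unique[OF I[unfolded eq]])
qed

text \<open>In coordinates centred at the midpoint, the quadratic terms are taken with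
  mean value zero, which decouples the five equations.\<close>

lemma EQ_shape_unisolvent:
  assumes "a1 < b1" "a2 < b2"
  defines "K \<equiv> ((a1, a2), (b1, b2))"
  shows "\<exists>p\<in>EQ_shape. cell_integral K p = w \<and> (\<forall>e\<in>cell_edges K. edge_integral e p = m e)"
proof -
  let ?h = "b1 - a1" and ?k = "b2 - a2" and ?m1 = "(a1 + b1) / 2" and ?m2 = "(a2 + b2) / 2"
  define r l t s where "r = m ((b1, a2), (b1, b2)) / ?k" "l = m ((a1, a2), (a1, b2)) / ?k"
    "t = m ((a1, b2), (b1, b2)) / ?h" "s = m ((a1, a2), (b1, a2)) / ?h"
  define W where "W = w / (?h * ?k)"
  \<comment> \<open>\<open>W\<close> is the cell mean, and r, l, t, s are the means on the right,
    left, top and bottom edge. Matching r and l gives r - l = B h and r + l = 2 W + D h^2 / 3, since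
    (h/2)^2 - h^2 / 12 = h^2 / 6; likewise for t and s.\<close>
  define B C D E where "B = (r - l) / ?h" "C = (t - s) / ?k"
    "D = 3 * (r + l - 2 * W) / ?h\<^sup>2" "E = 3 * (t + s - 2 * W) / ?k\<^sup>2"
  let ?X = "\<lambda>x. B * (x - ?m1) + D * ((x - ?m1)\<^sup>2 - ?h\<^sup>2 / 12)"
  let ?Y = "\<lambda>y. C * (y - ?m2) + E * ((y - ?m2)\<^sup>2 - ?k\<^sup>2 / 12)"
  define p :: "point \<Rightarrow> real" where "p = (\<lambda>(x, y). W + ?X x + ?Y y)"
  have "p = (\<lambda>(x, y). (W - B * ?m1 + D * (?m1\<^sup>2 - ?h\<^sup>2 / 12) - C * ?m2 + E * (?m2\<^sup>2 - ?k\<^sup>2 / 12))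
      + (B - 2 * D * ?m1) * x + (C - 2 * E * ?m2) * y + D * x\<^sup>2 + E * y\<^sup>2)"
    unfolding p_def by (auto simp: fun_eq_iff power2_diff algebra_simps)
  then have p: "p \<in> EQ_shape"
    unfolding EQ_shape_def by blast
  have cont: "continuous_on S p" for S
    by (rule C1_continuous[OF EQ_shape_C1[OF p]])
  have Ix: "integral {a1..b1} (\<lambda>x. p (x, y)) = (W + ?Y y) * ?h" for y
    using integral_quadratic_centred[OF assms(1), of "W + ?Y y" B D]
    by (simp add: p_def algebra_simps)
  have Iy: "integral {a2..b2} (\<lambda>y. p (x, y)) = (W + ?X x) * ?k" for x
    using integral_quadratic_centred[OF assms(2), of "W + ?X x" C E]
    by (simp add: p_def algebra_simps)
  have "cell_integral K p = integral {a1..b1} (\<lambda>x. (W + ?X x) * ?k)"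
    using integral_prod_continuous[OF cont, of a1 a2 b1 b2] by (simp add: cell_integral_def K_def Iy)
  also have "\<dots> = W * ?h * ?k"
    using integral_quadratic_centred[OF assms(1), of W B D] by (simp add: add.assoc)
  finally have "cell_integral K p = w"
    using assms by (simp add: W_def)
  moreover have hk: "?h \<noteq> 0" "?k \<noteq> 0" using assms by auto
  have "?X b1 = B * ?h / 2 + D * ?h\<^sup>2 / 6" "?X a1 = - (B * ?h / 2) + D * ?h\<^sup>2 / 6"
    "?Y b2 = C * ?k / 2 + E * ?k\<^sup>2 / 6" "?Y a2 = - (C * ?k / 2) + E * ?k\<^sup>2 / 6"
    by (simp_all add: field_simps power2_eq_square)
  moreover have "B * ?h = r - l" "D * ?h\<^sup>2 = 3 * (r + l - 2 * W)" "C * ?k = t - s" "E * ?k\<^sup>2 = 3 * (t + s - 2 * W)"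
    using hk by (simp_all add: B_C_D_E_def)
  ultimately have "W + ?X b1 = r" "W + ?X a1 = l" "W + ?Y b2 = t" "W + ?Y a2 = s"
    by (simp_all add: field_simps)
  then have "\<forall>e\<in>cell_edges K. edge_integral e p = m e"
    using assms(1,2) hk
    by (simp add: K_def edge_integral_horizontal edge_integral_vertical cont Ix Iy r_l_t_s_def)
  with \<open>cell_integral K p = w\<close> p show ?thesis by blast
qed

text \<open>Each component depends on its own variable only and is the linear interpolation of the
  values on two opposite edges.\<close>

lemma RT_unisolvent:
  assumes "a1 < b1" "a2 < b2"
  shows "\<exists>c. \<forall>e\<in>cell_edges ((a1, a2), (b1, b2)). flux c e = m e"
proof -
  define l r s t where "l = m ((a1, a2), (a1, b2))" "r = m ((b1, a2), (b1, b2))"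
    "s = m ((a1, a2), (b1, a2))" "t = m ((a1, b2), (b1, b2))"
  define b d where "b = (r - l) / (b1 - a1)" "d = (t - s) / (b2 - a2)"
  have "b * (b1 - a1) = r - l" "d * (b2 - a2) = t - s" using assms by (auto simp: b_d_def)
  then have "l - b * a1 + b * b1 = r" "s - d * a2 + d * b2 = t"
    by (simp_all add: right_diff_distrib)
  then have "flux (l - b * a1, b, s - d * a2, d) e = m e" if "e \<in> cell_edges ((a1, a2), (b1, b2))" for e
    using that assms by (auto simp: flux_def normal_comp_def l_r_s_t_def)
  then show ?thesis by blast
qed

text \<open>Each component of \<open>rt_fun c\<close> depends on its own variable only, so the field
  is integrated termwise; the additive constant \<open>A\<close> then adjusts the cell
  integral.\<close>

lemma EQ_shape_of_grad:
  assumes "a1 < b1" "a2 < b2"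
  shows "\<exists>p\<in>EQ_shape. grad p = rt_fun c \<and> cell_integral ((a1, a2), (b1, b2)) p = w"
proof -
  obtain \<alpha> \<beta> \<gamma> \<delta> where c: "c = (\<alpha>, \<beta>, \<gamma>, \<delta>)" by (metis prod_cases4)
  let ?K = "((a1, a2), (b1, b2))"
  let ?p = "\<lambda>A (x, y). A + \<alpha> * x + \<gamma> * y + (\<beta> / 2) * x\<^sup>2 + (\<delta> / 2) * y\<^sup>2"
  have p: "?p A \<in> EQ_shape" for A unfolding EQ_shape_def by blast
  have g: "grad (?p A) = rt_fun c" for A
  proof
    show "grad (?p A) z = rt_fun c z" for z
      using grad_eqI[OF EQ_shape_has_derivative[of A \<alpha> \<gamma> "\<beta> / 2" "\<delta> / 2" z]]
      by (cases z) (simp add: c)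
  qed
  define A where "A = (w - cell_integral ?K (?p 0)) / ((b1 - a1) * (b2 - a2))"
  define q where "q = ?p 0"
  have q: "continuous_on S q" for S
    unfolding q_def by (rule C1_continuous[OF EQ_shape_C1[OF p]])
  have "cell_integral ?K (?p A) = cell_integral ?K (\<lambda>z. A + q z)"
    by (simp add: q_def case_prod_unfold add.assoc)
  also have "\<dots> = A * ((b1 - a1) * (b2 - a2)) + cell_integral ?K (?p 0)"
    unfolding cell_integral_def q_def[symmetric]
    using assms q by (subst integral_add) (auto simp: content_Pair intro!: integrable_continuous)
  also have "\<dots> = w" using assms by (simp add: A_def)
  finally show ?thesis using p g by blast
qed

section \<open>Gluing cell functions; the projection onto piecewise constants\<close>

context rect_domain begin

text \<open>Turns a family of cell functions into the representative prescribed by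
  \<open>piecewise\<close>, zero off the open cells, so that equality in the discrete spaces can be
  shown cell by cell.\<close>

definition glue :: "(cell \<Rightarrow> point \<Rightarrow> 'b::euclidean_space) \<Rightarrow> point \<Rightarrow> 'b" where
  "glue g z = (if \<exists>K\<in>T. z \<in> box (fst K) (snd K) then g (THE K. K \<in> T \<and> z \<in> box (fst K) (snd K)) z else 0)"

lemma glue_eq:
  assumes "K \<in> T" "z \<in> box (fst K) (snd K)"
  shows "glue g z = g K z"
proof -
  have "(THE K. K \<in> T \<and> z \<in> box (fst K) (snd K)) = K"
    using assms cell_unique box_subset_cbox by (intro the_equality) blast+
  then show ?thesis using assms unfolding glue_def by auto
qed

lemma glue_outside: "z \<notin> (\<Union>K\<in>T. box (fst K) (snd K)) \<Longrightarrow> glue g z = 0"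
  unfolding glue_def by auto

lemma piecewise_iff:
  "v \<in> piecewise T P \<longleftrightarrow> (\<exists>g. (\<forall>K\<in>T. g K \<in> P) \<and> v = glue g)"
proof
  assume v: "v \<in> piecewise T P"
  then have "\<forall>K\<in>T. \<exists>p. p \<in> P \<and> (\<forall>z\<in>box (fst K) (snd K). v z = p z)"
    unfolding piecewise_def by fastforce
  then obtain g where g: "\<forall>K\<in>T. g K \<in> P \<and> (\<forall>z\<in>box (fst K) (snd K). v z = g K z)"
    by metis
  have "v z = glue g z" for z
  proof (cases "z \<in> (\<Union>K\<in>T. box (fst K) (snd K))")
    case True
    then obtain K where "K \<in> T" "z \<in> box (fst K) (snd K)" by blast
    then show ?thesis using g glue_eq[of K z g] by simp
  next
    case False
    then show ?thesis using v glue_outside[of z g] by (simp add: piecewise_def case_prod_unfold)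
  qed
  with g show "\<exists>g. (\<forall>K\<in>T. g K \<in> P) \<and> v = glue g" by blast
next
  assume "\<exists>g. (\<forall>K\<in>T. g K \<in> P) \<and> v = glue g"
  then obtain g where g: "\<forall>K\<in>T. g K \<in> P" "v = glue g" by blast
  have "\<exists>p\<in>P. \<forall>z\<in>box (fst K) (snd K). v z = p z" if "K \<in> T" for K
    using g that by (intro bexI[of _ "g K"]) (auto simp: glue_eq)
  moreover have "v z = 0" if "z \<notin> (\<Union>K\<in>T. box (fst K) (snd K))" for z
    unfolding g(2) using that by (rule glue_outside)
  ultimately show "v \<in> piecewise T P"
    by (simp add: piecewise_def case_prod_unfold)
qed

lemma patch_glue: "(\<And>K. K \<in> T \<Longrightarrow> continuous_on UNIV (g K)) \<Longrightarrow> patch (glue g) g"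
  by (simp add: patch_def glue_eq)

lemma patch_rt: "patch (glue (\<lambda>K. rt_fun (c K))) (\<lambda>K. rt_fun (c K))"
  by (intro patch_glue continuous_on_rt_fun)

lemma patch_const: "patch (glue (\<lambda>K z. w K)) (\<lambda>K z. w K)"
  by (intro patch_glue continuous_on_const)

lemma glue_cong:
  assumes "\<And>K z. K \<in> T \<Longrightarrow> z \<in> box (fst K) (snd K) \<Longrightarrow> g K z = h K z"
  shows "glue g = glue h"
proof
  fix z
  show "glue g z = glue h z"
  proof (cases "z \<in> (\<Union>K\<in>T. box (fst K) (snd K))")
    case True
    then obtain K where "K \<in> T" "z \<in> box (fst K) (snd K)" by blast
    then show ?thesis using assms[of K z] by (simp add: glue_eq)
  qed (simp add: glue_outside)
qed

lemma P0_space_eq: "P0_space \<Omega> T = range (\<lambda>w. glue (\<lambda>K z. w K))"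
proof
  show "range (\<lambda>w. glue (\<lambda>K z. w K)) \<subseteq> P0_space \<Omega> T"
    using patch_L2[OF patch_const] by (auto simp: P0_space_def piecewise_iff intro!: exI)
  show "P0_space \<Omega> T \<subseteq> range (\<lambda>w. glue (\<lambda>K z. w K))"
  proof
    fix v assume "v \<in> P0_space \<Omega> T"
    then obtain g where g: "\<forall>K\<in>T. \<exists>c. g K = (\<lambda>z. c)" "v = glue g"
      by (auto simp: P0_space_def piecewise_iff simp del: split_paired_All)
    then have "v = glue (\<lambda>K z. g K 0)"
      by (auto intro!: glue_cong)
    then show "v \<in> range (\<lambda>w. glue (\<lambda>K z. w K))" by auto
  qed
qed

lemma P0_spaceI: "glue (\<lambda>K z. w K) \<in> P0_space \<Omega> T"
  unfolding P0_space_eq by (rule range_eqI[where x=w]) simp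

definition area :: "cell \<Rightarrow> real" where
  "area K = measure lborel (cbox (fst K) (snd K))"

lemma area_pos: "K \<in> T \<Longrightarrow> area K > 0"
  by (erule cell_shape) (simp add: area_def content_Pair)

lemma cell_integral_mult_const:
  "cell_integral K (\<lambda>z. f z * c) = cell_integral K f * c" "cell_integral K (\<lambda>z. c * f z) = c * cell_integral K f" for c :: real
  by (simp_all add: cell_integral_def)

lemma cell_integral_const: "cell_integral K (\<lambda>z. c) = c * area K" for c :: real
  by (simp add: cell_integral_def area_def)

lemma cell_integral_add:
  "continuous_on UNIV f \<Longrightarrow> continuous_on UNIV g \<Longrightarrow> cell_integral K (\<lambda>z. f z + g z) = cell_integral K f + cell_integral K g"
  unfolding cell_integral_def by (intro integral_add integrable_continuous) (auto intro: continuous_on_subset)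

lemma l2_inner_P0:
  assumes "patch f g"
  shows "l2_inner \<Omega> f (glue (\<lambda>K z. w K)) = (\<Sum>K\<in>T. cell_integral K (g K) * w K)"
  by (simp add: l2_inner_patch[OF assms patch_const] cell_integral_mult_const)

lemma l2_inner_commute: "l2_inner \<Omega> f g = l2_inner \<Omega> g f"
  by (simp add: l2_inner_def inner_commute)

lemma patch_diff: "patch f g \<Longrightarrow> patch f' g' \<Longrightarrow> patch (\<lambda>z. f z - f' z) (\<lambda>K z. g K z - g' K z)"
  by (auto simp: patch_def intro!: continuous_intros)

text \<open>Orthogonality to piecewise constants decouples over the cells: the indicator of a single
  cell as test function forces the value there to be the cell mean.\<close>

lemma proj0_patch:
  assumes "patch v p"
  shows "proj0 \<Omega> T v = glue (\<lambda>K z. cell_integral K (p K) / area K)"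
  unfolding proj0_def
proof (rule the_equality)
  let ?w = "\<lambda>K. cell_integral K (p K) / area K"
  have cont: "K \<in> T \<Longrightarrow> continuous_on UNIV (p K)" for K using assms by (auto simp: patch_def)
  have inner: "l2_inner \<Omega> (\<lambda>z. v z - glue (\<lambda>K z. w K) z) (glue (\<lambda>K z. q K)) =
      (\<Sum>K\<in>T. (cell_integral K (p K) - w K * area K) * q K)" for w q
  proof -
    have "cell_integral K (\<lambda>z. p K z - w K) = cell_integral K (p K) - w K * area K" if "K \<in> T" for K
      using cell_integral_add[OF cont[OF that], of "\<lambda>z. - w K" K] cell_integral_const[of K "- w K"] by simp
    then show ?thesis
      by (simp add: l2_inner_P0[OF patch_diff[OF assms patch_const]])
  qed
  have "cell_integral K (p K) - ?w K * area K = 0" if "K \<in> T" for K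
    using area_pos[OF that] by simp
  then show "glue (\<lambda>K z. ?w K) \<in> P0_space \<Omega> T \<and>
      (\<forall>q\<in>P0_space \<Omega> T. l2_inner \<Omega> (\<lambda>z. v z - glue (\<lambda>K z. ?w K) z) q = 0)"
    by (auto simp: P0_space_eq inner)
  fix w' assume w': "w' \<in> P0_space \<Omega> T \<and> (\<forall>q\<in>P0_space \<Omega> T. l2_inner \<Omega> (\<lambda>z. v z - w' z) q = 0)"
  then obtain w where w: "w' = glue (\<lambda>K z. w K)" by (auto simp: P0_space_eq)
  have "w K = ?w K" if K: "K \<in> T" for K
  proof -
    have "(\<Sum>K'\<in>T. (cell_integral K' (p K') - w K' * area K') * (if K' = K then 1 else 0)) = 0"
      unfolding inner[symmetric]
      using w' P0_spaceI[of "\<lambda>K'. if K' = K then 1 else 0"] unfolding w by blast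
    then show ?thesis
      using K finite_T area_pos[OF K] by (simp add: field_simps if_distrib cong: if_cong)
  qed
  then show "w' = glue (\<lambda>K z. ?w K)"
    unfolding w by (intro glue_cong) simp
qed

section \<open>Green's formula summed over the mesh\<close>

lemma finite_mesh_edges: "finite (mesh_edges T)"
proof -
  have "finite (cell_edges K)" for K by (cases K rule: cell_edges.cases) simp
  then show ?thesis using finite_T by (auto simp: mesh_edges_def)
qed

lemma sum_over_edges:
  "(\<Sum>K\<in>T. \<Sum>e\<in>cell_edges K. F K e) = (\<Sum>e\<in>mesh_edges T. \<Sum>K\<in>{K\<in>T. e \<in> cell_edges K}. F K e)"
proof -
  have "(\<Sum>K\<in>T. \<Sum>e\<in>cell_edges K. F K e) = (\<Sum>K\<in>T. \<Sum>e\<in>{e\<in>mesh_edges T. e \<in> cell_edges K}. F K e)"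
    by (intro sum.cong refl) (auto simp: mesh_edges_def)
  also have "\<dots> = (\<Sum>e\<in>mesh_edges T. \<Sum>K\<in>{K\<in>T. e \<in> cell_edges K}. F K e)"
    by (rule sum.swap_restrict[OF finite_T finite_mesh_edges])
  finally show ?thesis .
qed

text \<open>\<open>green_cell\<close> summed over the cells and regrouped by edges. Nothing is
  assumed to match, so the identity serves to derive matching conditions as well as to exploit
  them.\<close>

lemma green_mesh:
  assumes u: "\<And>K. K \<in> T \<Longrightarrow> C1 (u K)"
  shows "(\<Sum>K\<in>T. cell_integral K (\<lambda>z. grad (u K) z \<bullet> rt_fun (c K) z)) + (\<Sum>K\<in>T. cell_integral K (u K) * rt_div (c K)) =
    (\<Sum>e\<in>mesh_edges T. \<Sum>K\<in>{K\<in>T. e \<in> cell_edges K}. osign K e * (flux (c K) e * edge_integral e (u K)))"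
proof -
  have "cell_integral K (\<lambda>z. grad (u K) z \<bullet> rt_fun (c K) z) + cell_integral K (u K) * rt_div (c K) =
      (\<Sum>e\<in>cell_edges K. osign K e * (flux (c K) e * edge_integral e (u K)))" if K: "K \<in> T" for K
  proof -
    have "continuous_on UNIV (grad (u K))" "continuous_on UNIV (u K)"
      using u[OF K] C1_continuous by (auto simp: C1_def)
    then have "cell_integral K (\<lambda>z. grad (u K) z \<bullet> rt_fun (c K) z) + cell_integral K (\<lambda>z. u K z * rt_div (c K)) =
        cell_integral K (\<lambda>z. grad (u K) z \<bullet> rt_fun (c K) z + u K z * rt_div (c K))"
      by (intro cell_integral_add[symmetric] continuous_intros continuous_on_rt_fun)
    moreover obtain a1 a2 b1 b2 where shape: "K = ((a1, a2), (b1, b2))" "a1 < b1" "a2 < b2"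
      using cell_shape[OF K] by blast
    ultimately show ?thesis
      using green_cell[OF u[OF K, unfolded shape(1)] shape(2,3), of "c K"]
      by (simp only: cell_integral_mult_const) (simp only: cell_integral_def shape(1) fst_conv snd_conv)
  qed
  then show ?thesis
    by (simp add: sum_over_edges flip: sum.distrib)
qed

text \<open>Fluxes on the remaining edges are free, since \<open>Hdiv\<close> imposes nothing on the
  normal trace at the boundary.\<close>

definition flux_matched :: "(cell \<Rightarrow> real \<times> real \<times> real \<times> real) \<Rightarrow> bool" where
  "flux_matched c \<longleftrightarrow> (\<forall>e K K'. interior_edge e \<longrightarrow> K \<in> T \<longrightarrow> K' \<in> T \<longrightarrow>
     e \<in> cell_edges K \<longrightarrow> e \<in> cell_edges K' \<longrightarrow> flux (c K) e = flux (c K') e)"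

text \<open>The counterpart of \<open>flux_matched\<close>, with a zero condition where fluxes are
  free; on a slit it holds from either side.\<close>

definition edge_matched :: "(cell \<Rightarrow> point \<Rightarrow> real) \<Rightarrow> bool" where
  "edge_matched u \<longleftrightarrow> (\<forall>e\<in>mesh_edges T. \<forall>K\<in>T. e \<in> cell_edges K \<longrightarrow>
     (\<not> interior_edge e \<longrightarrow> edge_integral e (u K) = 0) \<and>
     (\<forall>K'\<in>T. e \<in> cell_edges K' \<longrightarrow> interior_edge e \<longrightarrow> edge_integral e (u K) = edge_integral e (u K')))"

text \<open>Exactly two cells contribute, with opposite signs, so the sum is the difference of their
  values.\<close>

lemma interior_edge_sum:
  assumes "interior_edge e"
  shows "(\<Sum>K\<in>{K\<in>T. e \<in> cell_edges K}. osign K e * f K) = 0 \<longleftrightarrow>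
    (\<forall>K\<in>T. \<forall>K'\<in>T. e \<in> cell_edges K \<longrightarrow> e \<in> cell_edges K' \<longrightarrow> f K = f K')"
proof -
  obtain K K' where K: "K \<noteq> K'" "{K \<in> T. e \<in> cell_edges K} = {K, K'}" "osign K e = 1" "osign K' e = - 1"
    using interior_edge_cells[OF assms] by blast
  then have "(\<Sum>K\<in>{K\<in>T. e \<in> cell_edges K}. osign K e * f K) = f K - f K'" by simp
  moreover have "(\<forall>K\<in>T. \<forall>K'\<in>T. e \<in> cell_edges K \<longrightarrow> e \<in> cell_edges K' \<longrightarrow> f K = f K') \<longleftrightarrow>
      (\<forall>K\<in>{K \<in> T. e \<in> cell_edges K}. \<forall>K'\<in>{K \<in> T. e \<in> cell_edges K}. f K = f K')"
    by blast
  ultimately show ?thesis unfolding K(2) by auto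
qed

text \<open>Used with a test function as \<open>u\<close> to obtain a weak divergence, and with
  \<open>EQ\<close> functions to pass between the two eigenvalue problems.\<close>

lemma green_matched:
  assumes "\<And>K. K \<in> T \<Longrightarrow> C1 (u K)" and c: "flux_matched c" and u: "edge_matched u"
  shows "(\<Sum>K\<in>T. cell_integral K (\<lambda>z. grad (u K) z \<bullet> rt_fun (c K) z)) = - (\<Sum>K\<in>T. cell_integral K (u K) * rt_div (c K))"
proof -
  have "(\<Sum>K\<in>{K\<in>T. e \<in> cell_edges K}. osign K e * (flux (c K) e * edge_integral e (u K))) = 0"
    if e: "e \<in> mesh_edges T" for e
  proof (cases "interior_edge e")
    case True
    have "flux (c K) e * edge_integral e (u K) = flux (c K') e * edge_integral e (u K')"
      if "K \<in> T" "K' \<in> T" "e \<in> cell_edges K" "e \<in> cell_edges K'" for K K'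
      using c u True e that unfolding flux_matched_def edge_matched_def by metis
    then show ?thesis by (subst interior_edge_sum[OF True]) blast
  next
    case False
    then show ?thesis using u e by (intro sum.neutral) (auto simp: edge_matched_def simp del: split_paired_All)
  qed
  then show ?thesis using green_mesh[of u c] assms(1) by simp
qed

end

subsection \<open>Weak divergence and matching fluxes\<close>

context rect_domain begin

text \<open>The bounded domain has finite measure, and 1 + d^2 dominates the absolute value of
  d.\<close>

lemma L2_integrable:
  fixes d :: "point \<Rightarrow> real"
  assumes "d \<in> L2 \<Omega>"
  shows "integrable (lebesgue_on \<Omega>) d"
proof -
  have d: "d \<in> borel_measurable (lebesgue_on \<Omega>)" "integrable (lebesgue_on \<Omega>) (\<lambda>z. (norm (d z))\<^sup>2)"
    using assms by (auto simp: L2_def)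
  have "\<Omega> \<in> lmeasurable"
    using open_domain bounded_domain by (rule lmeasurable_open[rotated])
  then interpret finite_measure "lebesgue_on \<Omega>" by (rule finite_measure_lebesgue_on)
  have "integrable (lebesgue_on \<Omega>) (\<lambda>z. 1 + (norm (d z))\<^sup>2)"
    using d(2) by simp
  then show ?thesis
  proof (rule Bochner_Integration.integrable_bound)
    have "\<bar>d z\<bar> \<le> 1 + (d z)\<^sup>2" for z
      using zero_le_power2[of "\<bar>d z\<bar> - 1"] by (simp add: power2_diff)
    then show "AE z in lebesgue_on \<Omega>. norm (d z) \<le> norm (1 + (norm (d z))\<^sup>2)" by simp
  qed (fact d(1))
qed

lemma l2_inner_tendsto:
  fixes d :: "point \<Rightarrow> real"
  assumes d: "integrable (lebesgue_on \<Omega>) d"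
    and \<phi>: "\<And>n. continuous_on UNIV (\<phi> n)" "\<And>n z. \<bar>\<phi> n z\<bar> \<le> 1"
    and lim: "negligible N" "\<And>z. z \<notin> N \<Longrightarrow> (\<lambda>n. \<phi> n z) \<longlonglongrightarrow> h z"
    and h: "h \<in> borel_measurable lebesgue"
  shows "(\<lambda>n. l2_inner \<Omega> d (\<phi> n)) \<longlonglongrightarrow> l2_inner \<Omega> d h"
  unfolding l2_inner_def inner_real_def
proof (rule integral_dominated_convergence[where w="\<lambda>z. \<bar>d z\<bar>"])
  have dm: "d \<in> borel_measurable (lebesgue_on \<Omega>)" using d by auto
  show "(\<lambda>z. d z * h z) \<in> borel_measurable (lebesgue_on \<Omega>)"
    using h by (intro borel_measurable_times dm measurable_restrict_space1)
  show "(\<lambda>z. d z * \<phi> n z) \<in> borel_measurable (lebesgue_on \<Omega>)" for n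
    by (intro borel_measurable_times dm continuous_imp_measurable_on_sets_lebesgue sets_domain
        continuous_on_subset[OF \<phi>(1)] subset_UNIV)
  show "integrable (lebesgue_on \<Omega>) (\<lambda>z. \<bar>d z\<bar>)" using d by simp
  have "AE z in lebesgue. z \<notin> N"
    using lim(1) by (simp add: negligible_iff_null_sets AE_not_in)
  then have "AE z in lebesgue_on \<Omega>. z \<notin> N"
    using sets_domain by (subst AE_restrict_space_iff) auto
  then show "AE z in lebesgue_on \<Omega>. (\<lambda>n. d z * \<phi> n z) \<longlonglongrightarrow> d z * h z"
    by eventually_elim (intro tendsto_mult tendsto_const lim(2))
  show "AE z in lebesgue_on \<Omega>. norm (d z * \<phi> n z) \<le> \<bar>d z\<bar>" for n
    using \<phi>(2) by (intro AE_I2) (simp add: abs_mult mult_left_le)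
qed

lemma test_function_continuous: "\<phi> \<in> test_functions \<Omega> \<Longrightarrow> continuous_on S \<phi>"
  by (intro C1_continuous test_function_C1)

text \<open>Stands in for almost everywhere uniqueness of the weak divergence. Products of windows
  are test functions, for which both sides agree by definition, and dominated convergence carries
  the equality over to the indicator.\<close>

lemma l2_inner_indicator_weak_div:
  assumes "d \<in> L2 \<Omega>" "d' \<in> L2 \<Omega>" "is_weak_div \<Omega> \<tau> d" "is_weak_div \<Omega> \<tau> d'"
    and sub: "box (a1, a2) (b1, b2) \<subseteq> \<Omega>"
  shows "l2_inner \<Omega> d (indicator (box (a1, a2) (b1, b2))) = l2_inner \<Omega> d' (indicator (box (a1, a2) (b1, b2)))"
proof -
  let ?\<phi> = "\<lambda>n (z :: point). window a1 b1 n (fst z) * window a2 b2 n (snd z)"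
  let ?h = "indicator (box (a1, a2) (b1, b2)) :: point \<Rightarrow> real"
  have test: "?\<phi> n \<in> test_functions \<Omega>" for n
  proof (rule product_in_test_functions)
    define r where "r = 1 / real (Suc n)"
    have "r > 0" by (simp add: r_def)
    then have "cbox (a1 + r, a2 + r) (b1 - r, b2 - r) \<subseteq> \<Omega>"
      by (intro subset_trans[OF _ sub]) (auto simp: cbox_Pair_eq mem_box_Pair)
    then show "cbox (a1 + 1 / real (Suc n), a2 + 1 / real (Suc n)) (b1 - 1 / real (Suc n), b2 - 1 / real (Suc n)) \<subseteq> \<Omega>"
      by (simp only: r_def)
  qed (use Dk_window window_support in auto)
  have lim: "(\<lambda>n. l2_inner \<Omega> e (?\<phi> n)) \<longlonglongrightarrow> l2_inner \<Omega> e ?h" if "e \<in> L2 \<Omega>" for e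
  proof (rule l2_inner_tendsto[OF L2_integrable[OF that], where N="{}"])
    show "negligible ({} :: point set)" by simp
    show "\<bar>?\<phi> n z\<bar> \<le> 1" for n z
      by (simp add: abs_mult window_bounds mult_le_one)
    show "(\<lambda>n. ?\<phi> n z) \<longlonglongrightarrow> ?h z" for z
    proof -
      have "?h z = indicator {a1<..<b1} (fst z) * indicator {a2<..<b2} (snd z)"
        by (cases z) (auto simp: mem_box_Pair indicator_def)
      then show ?thesis by (simp only:) (intro tendsto_mult window_tendsto)
    qed
    show "?h \<in> borel_measurable lebesgue"
      by (intro borel_measurable_indicator) auto
  qed (rule test_function_continuous[OF test])
  have "l2_inner \<Omega> d (?\<phi> n) = l2_inner \<Omega> d' (?\<phi> n)" for n
    using assms(3,4) test[of n] by (auto simp: is_weak_div_def)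
  then show ?thesis
    using LIMSEQ_unique[OF lim[OF assms(1)]] lim[OF assms(2)] by simp
qed

lemma l2_inner_P0_weak_div:
  assumes d: "d \<in> L2 \<Omega>" "d' \<in> L2 \<Omega>" "is_weak_div \<Omega> \<tau> d" "is_weak_div \<Omega> \<tau> d'"
  shows "l2_inner \<Omega> d (glue (\<lambda>K z. w K)) = l2_inner \<Omega> d' (glue (\<lambda>K z. w K))"
proof -
  let ?B = "\<lambda>K::cell. box (fst K) (snd K)"
  have glue: "glue (\<lambda>K z. w K) z = (\<Sum>K\<in>T. w K * indicator (?B K) z)" for z
  proof (cases "z \<in> (\<Union>K\<in>T. ?B K)")
    case True
    then obtain K where K: "K \<in> T" "z \<in> ?B K" by blast
    have "indicator (?B K') z = (if K' = K then 1 else 0 :: real)" if "K' \<in> T" for K'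
    proof (cases "K' = K")
      case False
      then have "z \<notin> ?B K'"
        using cell_unique[OF K(1) that K(2)] box_subset_cbox[of "fst K'" "snd K'"] by blast
      then show ?thesis using False by simp
    qed (use K(2) in simp)
    then have "(\<Sum>K\<in>T. w K * indicator (?B K) z) = (\<Sum>K'\<in>T. if K' = K then w K' else 0)"
      by (intro sum.cong refl) simp
    then show ?thesis using K finite_T by (simp add: glue_eq)
  qed (auto simp: glue_outside)
  have expand: "l2_inner \<Omega> e (glue (\<lambda>K z. w K)) = (\<Sum>K\<in>T. w K * l2_inner \<Omega> e (indicator (?B K)))"
    if e: "e \<in> L2 \<Omega>" for e
  proof -
    have "integrable (lebesgue_on \<Omega>) (\<lambda>z. e z * indicator (?B K) z)" if K: "K \<in> T" for K
    proof (rule integrable_real_mult_indicator[OF _ L2_integrable[OF e]])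
      have "?B K = \<Omega> \<inter> ?B K" using box_subset[OF K] by blast
      then show "?B K \<in> sets (lebesgue_on \<Omega>)"
        by (auto simp: sets_restrict_space intro!: image_eqI[of _ _ "?B K"])
    qed
    then have "(LINT z|lebesgue_on \<Omega>. (\<Sum>K\<in>T. w K * (e z * indicator (?B K) z))) =
        (\<Sum>K\<in>T. (LINT z|lebesgue_on \<Omega>. w K * (e z * indicator (?B K) z)))"
      by (intro Bochner_Integration.integral_sum integrable_mult_right)
    moreover have "l2_inner \<Omega> e (glue (\<lambda>K z. w K)) = (LINT z|lebesgue_on \<Omega>. (\<Sum>K\<in>T. w K * (e z * indicator (?B K) z)))"
      by (simp add: l2_inner_def glue sum_distrib_left mult.left_commute)
    ultimately show ?thesis by (simp add: l2_inner_def)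
  qed
  have "l2_inner \<Omega> d (indicator (?B K)) = l2_inner \<Omega> d' (indicator (?B K))" if "K \<in> T" for K
    using l2_inner_indicator_weak_div[OF d, of "fst (fst K)" "snd (fst K)" "fst (snd K)" "snd (snd K)"]
      box_subset[OF that] by simp
  then show ?thesis by (simp add: expand d)
qed

text \<open>The same function is used on all cells, so nothing jumps at interior edges; on the
  frontier it vanishes because its support lies in the open set \<Omega>.\<close>

lemma test_function_edge_matched:
  assumes "\<phi> \<in> test_functions \<Omega>"
  shows "edge_matched (\<lambda>K. \<phi>)"
proof -
  have "edge_integral e \<phi> = 0" if "e \<in> mesh_edges T" "\<not> interior_edge e" for e
  proof -
    have "closed_segment (fst e) (snd e) \<subseteq> frontier \<Omega>"
      using that by (auto simp: interior_edge_def)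
    moreover have "\<phi> z = 0" if "z \<in> frontier \<Omega>" for z
    proof (rule ccontr)
      assume "\<phi> z \<noteq> 0"
      then have "z \<in> closure {z. \<phi> z \<noteq> 0}"
        using closure_subset[of "{z. \<phi> z \<noteq> 0}"] by blast
      then have "z \<in> \<Omega>" using assms by (auto simp: test_functions_def)
      then show False using that open_domain by (auto simp: frontier_def interior_open)
    qed
    ultimately show ?thesis by (intro edge_integral_eq_0) blast
  qed
  then show ?thesis by (simp add: edge_matched_def)
qed

lemma patch_C1_grad: "C1 \<phi> \<Longrightarrow> patch (grad \<phi>) (\<lambda>K. grad \<phi>)" and patch_C1: "C1 \<phi> \<Longrightarrow> patch \<phi> (\<lambda>K. \<phi>)"
  by (auto simp: patch_def C1_continuous) (simp add: C1_def)

abbreviation rt_glue :: "(cell \<Rightarrow> real \<times> real \<times> real \<times> real) \<Rightarrow> point \<Rightarrow> point" where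
  "rt_glue c \<equiv> glue (\<lambda>K. rt_fun (c K))"

abbreviation div_glue :: "(cell \<Rightarrow> real \<times> real \<times> real \<times> real) \<Rightarrow> point \<Rightarrow> real" where
  "div_glue c \<equiv> glue (\<lambda>K z. rt_div (c K))"

lemma l2_inner_grad_C1:
  assumes "C1 \<phi>"
  shows "l2_inner \<Omega> (rt_glue c) (grad \<phi>) = (\<Sum>K\<in>T. cell_integral K (\<lambda>z. grad \<phi> z \<bullet> rt_fun (c K) z))"
    "l2_inner \<Omega> (div_glue c) \<phi> = (\<Sum>K\<in>T. cell_integral K \<phi> * rt_div (c K))"
  using l2_inner_patch[OF patch_C1_grad[OF assms] patch_rt, of c] l2_inner_P0[OF patch_C1[OF assms], of "\<lambda>K. rt_div (c K)"]
  by (simp_all add: l2_inner_commute)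

lemma weak_div_rt_glue:
  assumes "flux_matched c"
  shows "is_weak_div \<Omega> (rt_glue c) (div_glue c)"
  unfolding is_weak_div_def
proof
  fix \<phi> assume \<phi>: "\<phi> \<in> test_functions \<Omega>"
  note C1 = test_function_C1[OF \<phi>]
  show "l2_inner \<Omega> (rt_glue c) (grad \<phi>) = - l2_inner \<Omega> (div_glue c) \<phi>"
    unfolding l2_inner_grad_C1[OF C1]
    by (rule green_matched[OF C1 assms test_function_edge_matched[OF \<phi>]])
qed

text \<open>The test functions concentrate on the edge \<open>e\<close>, so that in the limit only the jump of the
  flux across \<open>e\<close> survives.\<close>

lemma flux_balance:
  assumes d: "d \<in> L2 \<Omega>" "is_weak_div \<Omega> (rt_glue c) d"
    and e: "e \<in> mesh_edges T"
    and test: "\<And>n. \<phi> n \<in> test_functions \<Omega>" and bound: "\<And>n z. \<bar>\<phi> n z\<bar> \<le> 1"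
    and lim: "negligible N" "\<And>z. z \<notin> N \<Longrightarrow> (\<lambda>n. \<phi> n z) \<longlonglongrightarrow> 0"
    and on_e: "\<And>n. edge_integral e (\<phi> n) = C" "C \<noteq> 0"
    and off_e: "\<And>n e'. e' \<in> mesh_edges T \<Longrightarrow> e' \<noteq> e \<Longrightarrow> edge_integral e' (\<phi> n) = 0"
  shows "(\<Sum>K\<in>{K\<in>T. e \<in> cell_edges K}. osign K e * flux (c K) e) = 0"
proof -
  let ?S = "\<Sum>K\<in>{K\<in>T. e \<in> cell_edges K}. osign K e * flux (c K) e"
  \<comment> \<open>The left side tends to 0, as both inner products are taken with functions
    vanishing in the limit off a null set; the right side does not depend on
    \<open>n\<close>.\<close>
  have S: "- l2_inner \<Omega> d (\<phi> n) + l2_inner \<Omega> (div_glue c) (\<phi> n) = ?S * C" for n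
  proof -
    note C1 = test_function_C1[OF test[of n]]
    have "- l2_inner \<Omega> d (\<phi> n) + l2_inner \<Omega> (div_glue c) (\<phi> n) =
        l2_inner \<Omega> (rt_glue c) (grad (\<phi> n)) + l2_inner \<Omega> (div_glue c) (\<phi> n)"
      using d(2) test[of n] by (simp add: is_weak_div_def)
    also have "\<dots> = (\<Sum>e'\<in>mesh_edges T. \<Sum>K\<in>{K\<in>T. e' \<in> cell_edges K}. osign K e' * (flux (c K) e' * edge_integral e' (\<phi> n)))"
      unfolding l2_inner_grad_C1[OF C1] by (rule green_mesh[OF C1])
    also have "\<dots> = (\<Sum>e'\<in>mesh_edges T. if e' = e then ?S * C else 0)"
      by (intro sum.cong refl) (auto simp: off_e on_e sum_distrib_right mult.assoc)
    finally show ?thesis using e finite_mesh_edges by simp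
  qed
  have lim0: "(\<lambda>n. l2_inner \<Omega> f (\<phi> n)) \<longlonglongrightarrow> l2_inner \<Omega> f (\<lambda>z. 0)" if "f \<in> L2 \<Omega>" for f
    by (rule l2_inner_tendsto[OF L2_integrable[OF that] _ bound lim])
      (auto intro: test_function_continuous[OF test])
  have "(\<lambda>n. - l2_inner \<Omega> d (\<phi> n) + l2_inner \<Omega> (div_glue c) (\<phi> n))
      \<longlonglongrightarrow> - l2_inner \<Omega> d (\<lambda>z. 0) + l2_inner \<Omega> (div_glue c) (\<lambda>z. 0)"
    by (intro tendsto_add tendsto_minus lim0 d(1) patch_L2[OF patch_const])
  then have "(\<lambda>n. ?S * C) \<longlonglongrightarrow> 0"
    unfolding S by (simp add: l2_inner_def)
  then show ?thesis using on_e(2) by (simp add: LIMSEQ_const_iff)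
qed

text \<open>Supplies the test functions for \<open>flux_balance\<close>: a spike across the edge
  times a hump along it, placed around a point of \<Omega> on the edge.\<close>

lemma flux_balance_vert:
  assumes d: "d \<in> L2 \<Omega>" "is_weak_div \<Omega> (rt_glue c) d"
    and e: "interior_edge (vert i j)" "i \<le> n1" "j \<in> {1..n2}"
  shows "(\<Sum>K\<in>{K\<in>T. vert i j \<in> cell_edges K}. osign K (vert i j) * flux (c K) (vert i j)) = 0"
proof -
  have e': "vert i j \<in> mesh_edges T" "\<not> closed_segment (fst (vert i j)) (snd (vert i j)) \<subseteq> frontier \<Omega>"
    using e(1) by (auto simp: interior_edge_def)
  obtain t where t: "y (j - 1) < t" "t < y j" "(x i, t) \<in> \<Omega>"
    using vert_interior[OF e'(1) e(2,3) e'(2)] by blast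
  obtain a1 a2 b1 b2 where R: "cbox (a1, a2) (b1, b2) \<subseteq> \<Omega>" "a1 < x i" "x i < b1" "a2 < t" "t < b2"
    using open_contains_cbox[OF open_domain t(3)] by (metis mem_box_Pair surj_pair)
  \<comment> \<open>\<delta> bounds the distance to all other vertical grid lines from below, so a
    narrower spike misses their edges.\<close>
  obtain \<delta> where \<delta>: "\<delta> > 0" "\<And>k. k \<le> n1 \<Longrightarrow> k \<noteq> i \<Longrightarrow> \<delta> \<le> \<bar>x k - x i\<bar>"
  proof -
    obtain \<delta> where "\<delta> > 0" "\<forall>s\<in>x ` {..n1}. s \<noteq> x i \<longrightarrow> \<delta> \<le> dist (x i) s"
      using finite_set_avoid[of "x ` {..n1}" "x i"] by auto
    moreover have "x k \<noteq> x i" if "k \<le> n1" "k \<noteq> i" for k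
      using strict_mono_on_grid_eq[OF mono_x that(1) e(2)] that by blast
    ultimately show thesis using that by (auto simp: dist_real_def abs_minus_commute)
  qed
  \<comment> \<open>Half-width of a strip that stays within the box \<open>R\<close> and off the
    other vertical grid lines. Shifting the index of the spike by \<open>N\<close> confines every
    member of the sequence to it.\<close>
  define r where "r = Min {\<delta>, x i - a1, b1 - x i}"
  have r: "r > 0" "r \<le> \<delta>" "a1 \<le> x i - r" "x i + r \<le> b1"
    using \<delta> R by (auto simp: r_def)
  obtain N where N: "1 / real (Suc N) < r"
    using nat_approx_posE[OF r(1)] by blast
  have Nn: "1 / real (Suc (N + n)) < r" for n
    by (rule le_less_trans[OF _ N]) (simp add: field_simps)
  \<comment> \<open>The hump is confined to \<open>R\<close>, for support in \<Omega>, and to the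
    extent of the edge, so that it vanishes on all horizontal edges and on the other edges of the
    same grid line.\<close>
  define p q where "p = max a2 (y (j - 1))" "q = min b2 (y j)"
  have pq: "p < t" "t < q" "a2 \<le> p" "q \<le> b2" "y (j - 1) \<le> p" "q \<le> y j"
    using t R by (auto simp: p_q_def)
  let ?\<phi> = "\<lambda>n (z :: point). spike (x i) (N + n) (fst z) * hump p q (snd z)"
  have spike_supp: "\<bar>s - x i\<bar> < r" if "spike (x i) (N + n) s \<noteq> 0" for n s
    using spike_support[OF that] Nn[of n] by linarith
  have test: "?\<phi> n \<in> test_functions \<Omega>" for n
  proof (rule product_in_test_functions)
    show "x i - r \<le> s \<and> s \<le> x i + r" if "spike (x i) (N + n) s \<noteq> 0" for s
      using spike_supp[OF that] by auto
    show "p \<le> s \<and> s \<le> q" if "hump p q s \<noteq> 0" for s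
      using that hump_support by auto
    show "cbox (x i - r, p) (x i + r, q) \<subseteq> \<Omega>"
      using r pq by (intro subset_trans[OF _ R(1)]) (auto simp: cbox_Pair_eq)
  qed (use Dk_spike Dk_hump in auto)
  show ?thesis
  proof (rule flux_balance[OF d e'(1) test])
    show "\<bar>?\<phi> n z\<bar> \<le> 1" for n z
      by (simp add: abs_mult spike_bounds hump_bounds mult_le_one)
    show "negligible {z :: point. z \<bullet> (1, 0) = x i}"
      by (rule negligible_standard_hyperplane) (simp add: Basis_prod_def)
    show "(\<lambda>n. ?\<phi> n z) \<longlonglongrightarrow> 0" if "z \<notin> {z. z \<bullet> (1, 0) = x i}" for z
    proof -
      have "(\<lambda>n. spike (x i) (n + N) (fst z)) \<longlonglongrightarrow> 0"
        using that by (intro LIMSEQ_ignore_initial_segment spike_tendsto_0) (simp add: inner_prod_def)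
      then show ?thesis
        using tendsto_mult_left_zero by (force simp: add.commute)
    qed
    have "edge_integral (vert i j) (?\<phi> n) = spike (x i) (N + n) (x i) * integral {y (j - 1)..y j} (hump p q)" for n
      unfolding vert_def using t test_function_continuous[OF test]
      by (subst edge_integral_vertical) auto
    then show "edge_integral (vert i j) (?\<phi> n) = ramp 1 * ramp 1 * integral {y (j - 1)..y j} (hump p q)" for n
      by (simp add: spike_centre)
    show "ramp 1 * ramp 1 * integral {y (j - 1)..y j} (hump p q) \<noteq> 0"
      using hump_integral_pos[of p q "y (j - 1)" "y j"] pq spike_centre(2) by auto
    fix n e' assume e': "e' \<in> mesh_edges T" "e' \<noteq> vert i j"
    show "edge_integral e' (?\<phi> n) = 0"
    proof (rule edge_integral_eq_0, rule ccontr)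
      fix z assume z: "z \<in> closed_segment (fst e') (snd e')" "?\<phi> n z \<noteq> 0"
      then have s: "\<bar>fst z - x i\<bar> < r" "y (j - 1) < snd z" "snd z < y j"
        using spike_supp hump_support[of p q "snd z"] pq by auto
      from e'(1) show False
      proof (cases rule: mesh_edge_cases)
        case (vert k l)
        have "fst z = x k" "y (l - 1) \<le> snd z" "snd z \<le> y l"
          using z(1) unfolding vert(1) segment_vert[OF vert(3)] by auto
        then have "k = i" "l = j"
          using \<delta>(2)[OF vert(2)] s r(2) strict_mono_on_grid_locate[OF mono_y e(3) vert(3) s(2,3)] by force+
        then show False using vert e'(2) by simp
      next
        case (hori k l)
        have "snd z = y l" using z(1) unfolding hori(1) segment_hori[OF hori(2)] by auto
        moreover have "j - 1 \<le> n2" "l \<le> n2" using e(3) hori(3) by auto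
        ultimately have "\<not> l \<le> j - 1" "\<not> j \<le> l"
          using s(2,3) strict_mono_on_grid_le[OF mono_y, of l "j - 1"] strict_mono_on_grid_le[OF mono_y, of j l]
          by linarith+
        then show False by linarith
      qed
    qed
  qed
qed

text \<open>The construction of \<open>flux_balance_vert\<close> with the coordinates
  exchanged.\<close>

lemma flux_balance_hori:
  assumes d: "d \<in> L2 \<Omega>" "is_weak_div \<Omega> (rt_glue c) d"
    and e: "interior_edge (hori i j)" "i \<in> {1..n1}" "j \<le> n2"
  shows "(\<Sum>K\<in>{K\<in>T. hori i j \<in> cell_edges K}. osign K (hori i j) * flux (c K) (hori i j)) = 0"
proof -
  have e': "hori i j \<in> mesh_edges T" "\<not> closed_segment (fst (hori i j)) (snd (hori i j)) \<subseteq> frontier \<Omega>"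
    using e(1) by (auto simp: interior_edge_def)
  obtain t where t: "x (i - 1) < t" "t < x i" "(t, y j) \<in> \<Omega>"
    using hori_interior[OF e'(1) e(2,3) e'(2)] by blast
  obtain a1 a2 b1 b2 where R: "cbox (a1, a2) (b1, b2) \<subseteq> \<Omega>" "a1 < t" "t < b1" "a2 < y j" "y j < b2"
    using open_contains_cbox[OF open_domain t(3)] by (metis mem_box_Pair surj_pair)
  obtain \<delta> where \<delta>: "\<delta> > 0" "\<And>k. k \<le> n2 \<Longrightarrow> k \<noteq> j \<Longrightarrow> \<delta> \<le> \<bar>y k - y j\<bar>"
  proof -
    obtain \<delta> where "\<delta> > 0" "\<forall>s\<in>y ` {..n2}. s \<noteq> y j \<longrightarrow> \<delta> \<le> dist (y j) s"
      using finite_set_avoid[of "y ` {..n2}" "y j"] by auto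
    moreover have "y k \<noteq> y j" if "k \<le> n2" "k \<noteq> j" for k
      using strict_mono_on_grid_eq[OF mono_y that(1) e(3)] that by blast
    ultimately show thesis using that by (auto simp: dist_real_def abs_minus_commute)
  qed
  define r where "r = Min {\<delta>, y j - a2, b2 - y j}"
  have r: "r > 0" "r \<le> \<delta>" "a2 \<le> y j - r" "y j + r \<le> b2"
    using \<delta> R by (auto simp: r_def)
  obtain N where N: "1 / real (Suc N) < r"
    using nat_approx_posE[OF r(1)] by blast
  have Nn: "1 / real (Suc (N + n)) < r" for n
    by (rule le_less_trans[OF _ N]) (simp add: field_simps)
  define p q where "p = max a1 (x (i - 1))" "q = min b1 (x i)"
  have pq: "p < t" "t < q" "a1 \<le> p" "q \<le> b1" "x (i - 1) \<le> p" "q \<le> x i"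
    using t R by (auto simp: p_q_def)
  let ?\<phi> = "\<lambda>n (z :: point). hump p q (fst z) * spike (y j) (N + n) (snd z)"
  have spike_supp: "\<bar>s - y j\<bar> < r" if "spike (y j) (N + n) s \<noteq> 0" for n s
    using spike_support[OF that] Nn[of n] by linarith
  have test: "?\<phi> n \<in> test_functions \<Omega>" for n
  proof (rule product_in_test_functions)
    show "y j - r \<le> s \<and> s \<le> y j + r" if "spike (y j) (N + n) s \<noteq> 0" for s
      using spike_supp[OF that] by auto
    show "p \<le> s \<and> s \<le> q" if "hump p q s \<noteq> 0" for s
      using that hump_support by auto
    show "cbox (p, y j - r) (q, y j + r) \<subseteq> \<Omega>"
      using r pq by (intro subset_trans[OF _ R(1)]) (auto simp: cbox_Pair_eq)
  qed (use Dk_spike Dk_hump in auto)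
  show ?thesis
  proof (rule flux_balance[OF d e'(1) test])
    show "\<bar>?\<phi> n z\<bar> \<le> 1" for n z
      by (simp add: abs_mult spike_bounds hump_bounds mult_le_one)
    show "negligible {z :: point. z \<bullet> (0, 1) = y j}"
      by (rule negligible_standard_hyperplane) (simp add: Basis_prod_def)
    show "(\<lambda>n. ?\<phi> n z) \<longlonglongrightarrow> 0" if "z \<notin> {z. z \<bullet> (0, 1) = y j}" for z
    proof -
      have "(\<lambda>n. spike (y j) (n + N) (snd z)) \<longlonglongrightarrow> 0"
        using that by (intro LIMSEQ_ignore_initial_segment spike_tendsto_0) (simp add: inner_prod_def)
      then show ?thesis
        using tendsto_mult_right_zero by (force simp: add.commute)
    qed
    have "edge_integral (hori i j) (?\<phi> n) = spike (y j) (N + n) (y j) * integral {x (i - 1)..x i} (hump p q)" for n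
      unfolding hori_def using t test_function_continuous[OF test]
      by (subst edge_integral_horizontal) (auto simp: mult.commute)
    then show "edge_integral (hori i j) (?\<phi> n) = ramp 1 * ramp 1 * integral {x (i - 1)..x i} (hump p q)" for n
      by (simp add: spike_centre)
    show "ramp 1 * ramp 1 * integral {x (i - 1)..x i} (hump p q) \<noteq> 0"
      using hump_integral_pos[of p q "x (i - 1)" "x i"] pq spike_centre(2) by auto
    fix n e' assume e': "e' \<in> mesh_edges T" "e' \<noteq> hori i j"
    show "edge_integral e' (?\<phi> n) = 0"
    proof (rule edge_integral_eq_0, rule ccontr)
      fix z assume z: "z \<in> closed_segment (fst e') (snd e')" "?\<phi> n z \<noteq> 0"
      then have s: "\<bar>snd z - y j\<bar> < r" "x (i - 1) < fst z" "fst z < x i"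
        using spike_supp hump_support[of p q "fst z"] pq by auto
      from e'(1) show False
      proof (cases rule: mesh_edge_cases)
        case (hori k l)
        have "snd z = y l" "x (k - 1) \<le> fst z" "fst z \<le> x k"
          using z(1) unfolding hori(1) segment_hori[OF hori(2)] by auto
        then have "l = j" "k = i"
          using \<delta>(2)[OF hori(3)] s r(2) strict_mono_on_grid_locate[OF mono_x e(2) hori(2) s(2,3)] by force+
        then show False using hori e'(2) by simp
      next
        case (vert k l)
        have "fst z = x k" using z(1) unfolding vert(1) segment_vert[OF vert(3)] by auto
        moreover have "i - 1 \<le> n1" "k \<le> n1" using e(2) vert(2) by auto
        ultimately have "\<not> k \<le> i - 1" "\<not> i \<le> k"
          using s(2,3) strict_mono_on_grid_le[OF mono_x, of k "i - 1"] strict_mono_on_grid_le[OF mono_x, of i k]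
          by linarith+
        then show False by linarith
      qed
    qed
  qed
qed

lemma flux_matched_iff:
  "flux_matched c \<longleftrightarrow> (\<forall>e. interior_edge e \<longrightarrow> (\<Sum>K\<in>{K\<in>T. e \<in> cell_edges K}. osign K e * flux (c K) e) = 0)"
proof -
  have "(\<Sum>K\<in>{K\<in>T. e \<in> cell_edges K}. osign K e * flux (c K) e) = 0 \<longleftrightarrow>
      (\<forall>K\<in>T. \<forall>K'\<in>T. e \<in> cell_edges K \<longrightarrow> e \<in> cell_edges K' \<longrightarrow> flux (c K) e = flux (c K') e)"
    if "interior_edge e" for e
    by (rule interior_edge_sum[OF that])
  then show ?thesis unfolding flux_matched_def by blast
qed

text \<open>Turns membership into finitely many linear conditions on coefficients. Necessity comes
  from the concentrating test functions; for sufficiency the elementwise divergence is a weak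
  divergence by Green's formula.\<close>

lemma RT_space_iff:
  "\<tau> \<in> RT_space \<Omega> T \<longleftrightarrow> (\<exists>c. \<tau> = rt_glue c \<and> flux_matched c)"
proof
  assume \<tau>: "\<tau> \<in> RT_space \<Omega> T"
  then obtain g where g: "\<forall>K\<in>T. g K \<in> range rt_fun" "\<tau> = glue g"
    by (auto simp: RT_space_def piecewise_iff QxQ_eq_range)
  then have "\<forall>K\<in>T. \<exists>c. g K = rt_fun c" by blast
  then obtain c where "\<forall>K\<in>T. g K = rt_fun (c K)" by metis
  then have c: "\<tau> = rt_glue c" using g(2) by (auto intro: glue_cong)
  obtain d where d: "d \<in> L2 \<Omega>" "is_weak_div \<Omega> (rt_glue c) d"
    using \<tau> by (auto simp: RT_space_def Hdiv_def c)
  have "(\<Sum>K\<in>{K\<in>T. e \<in> cell_edges K}. osign K e * flux (c K) e) = 0" if e: "interior_edge e" for e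
  proof -
    have "e \<in> mesh_edges T" using e by (simp add: interior_edge_def)
    then show ?thesis
      using flux_balance_vert[OF d] flux_balance_hori[OF d] e by (cases rule: mesh_edge_cases) auto
  qed
  then show "\<exists>c. \<tau> = rt_glue c \<and> flux_matched c"
    using c flux_matched_iff by blast
next
  assume "\<exists>c. \<tau> = rt_glue c \<and> flux_matched c"
  then obtain c where c: "\<tau> = rt_glue c" "flux_matched c" by blast
  have "\<tau> \<in> piecewise T QxQ"
    unfolding piecewise_iff QxQ_eq_range c by (intro exI conjI ballI) auto
  moreover have "\<tau> \<in> L2 \<Omega>" "div_glue c \<in> L2 \<Omega>"
    unfolding c by (rule patch_L2[OF patch_rt], rule patch_L2[OF patch_const])
  ultimately show "\<tau> \<in> RT_space \<Omega> T"
    using weak_div_rt_glue[OF c(2)] by (auto simp: RT_space_def Hdiv_def c(1))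
qed

text \<open>Whichever weak divergence is chosen, against piecewise constants it acts like the
  elementwise one.\<close>

lemma l2_inner_weak_div:
  assumes "flux_matched c"
  shows "l2_inner \<Omega> (weak_div \<Omega> (rt_glue c)) (glue (\<lambda>K z. w K)) = (\<Sum>K\<in>T. rt_div (c K) * area K * w K)"
proof -
  let ?P = "\<lambda>d. d \<in> L2 \<Omega> \<and> is_weak_div \<Omega> (rt_glue c) d"
  have d: "?P (div_glue c)"
    by (rule conjI[OF patch_L2[OF patch_const] weak_div_rt_glue[OF assms]])
  then have "?P (weak_div \<Omega> (rt_glue c))"
    unfolding weak_div_def by (rule someI[of ?P])
  then have "l2_inner \<Omega> (weak_div \<Omega> (rt_glue c)) (glue (\<lambda>K z. w K)) = l2_inner \<Omega> (div_glue c) (glue (\<lambda>K z. w K))"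
    using d by (intro l2_inner_P0_weak_div) auto
  then show ?thesis
    by (simp add: l2_inner_P0[OF patch_const] cell_integral_const)
qed

end

subsection \<open>Correspondence of the eigenpairs\<close>

context rect_domain begin

text \<open>Every point of the closed cell is a limit point of the open cell, so the limit defining
  the trace is unique and given by the continuous function \<open>p\<close>.\<close>

lemma cell_trace_eq:
  assumes K: "K \<in> T" and p: "continuous_on UNIV p" and v: "\<And>z. z \<in> box (fst K) (snd K) \<Longrightarrow> v z = p z"
    and z: "z \<in> cbox (fst K) (snd K)"
  shows "cell_trace K v z = p z"
  unfolding cell_trace_def
proof (rule tendsto_Lim)
  let ?B = "box (fst K) (snd K)"
  obtain a1 a2 b1 b2 where K': "K = ((a1, a2), (b1, b2))" "a1 < b1" "a2 < b2"
    using cell_shape[OF K] by blast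
  have "((a1 + b1) / 2, (a2 + b2) / 2) \<in> ?B" using K' by (simp add: mem_box_Pair)
  then have "z \<in> closure ?B" using z by (subst closure_box) auto
  then have "z islimpt ?B"
    by (auto simp: closure_def intro: interior_limit_point[of z ?B] simp: interior_open[OF open_box])
  then show "\<not> trivial_limit (at z within ?B)" by (simp add: trivial_limit_within)
  have "(p \<longlongrightarrow> p z) (at z within ?B)"
    by (rule tendsto_within_subset[OF _ subset_UNIV]) (use p in \<open>simp add: continuous_on_def\<close>)
  then show "(v \<longlongrightarrow> p z) (at z within ?B)"
    by (rule Lim_transform_eventually) (use v in \<open>auto simp: eventually_at_filter\<close>)
qed

lemma edge_integral_diff:
  assumes "continuous_on UNIV f" "continuous_on UNIV g"
  shows "edge_integral e (\<lambda>z. f z - g z) = edge_integral e f - edge_integral e g"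
proof -
  have "(\<lambda>t. h (linepath (fst e) (snd e) t)) integrable_on {0..1}" if "continuous_on UNIV h" for h :: "point \<Rightarrow> real"
    by (intro integrable_continuous_real continuous_on_compose2[OF that] continuous_on_linepath subset_UNIV)
  with assms show ?thesis
    by (simp add: edge_integral_def integral_diff right_diff_distrib)
qed

lemma EQ_space_iff:
  "v \<in> EQ_space \<Omega> T \<longleftrightarrow> (\<exists>p. v = glue p \<and> (\<forall>K\<in>T. p K \<in> EQ_shape) \<and> edge_matched p)"
proof -
  have jump_iff: "(\<forall>e\<in>mesh_edges T. \<forall>j\<in>jumps \<Omega> T (glue p) e. edge_integral e j = 0) \<longleftrightarrow> edge_matched p"
    if p: "\<forall>K\<in>T. p K \<in> EQ_shape" for p
  proof -
    have cont: "continuous_on UNIV (p K)" if "K \<in> T" for K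
      using p that by (intro C1_continuous EQ_shape_C1) blast
    have tr: "cell_trace K (glue p) z = p K z"
      if "K \<in> T" "e \<in> cell_edges K" "z \<in> closed_segment (fst e) (snd e)" for K e z
      by (rule cell_trace_eq[OF that(1) cont[OF that(1)]])
        (use glue_eq[OF that(1), of _ p] edge_subset_cbox[OF that(1,2)] that(3) in blast)+
    have single: "edge_integral e (cell_trace K (glue p)) = edge_integral e (p K)"
      if "K \<in> T" "e \<in> cell_edges K" for K e
      by (rule edge_integral_cong) (rule tr[OF that])
    have double: "edge_integral e (\<lambda>z. cell_trace K (glue p) z - cell_trace K' (glue p) z) =
        edge_integral e (p K) - edge_integral e (p K')"
      if "K \<in> T" "e \<in> cell_edges K" "K' \<in> T" "e \<in> cell_edges K'" for K K' e
      unfolding edge_integral_diff[OF cont[OF that(1)] cont[OF that(3)], symmetric]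
      by (rule edge_integral_cong) (simp add: tr[OF that(1,2)] tr[OF that(3,4)])
    have "(\<forall>j\<in>jumps \<Omega> T (glue p) e. edge_integral e j = 0) \<longleftrightarrow>
       (\<forall>K\<in>T. e \<in> cell_edges K \<longrightarrow>
         (\<not> interior_edge e \<longrightarrow> edge_integral e (p K) = 0) \<and>
         (\<forall>K'\<in>T. e \<in> cell_edges K' \<longrightarrow> interior_edge e \<longrightarrow> edge_integral e (p K) = edge_integral e (p K')))"
      if e: "e \<in> mesh_edges T" for e
    proof (cases "interior_edge e")
      case True
      then have "jumps \<Omega> T (glue p) e = {(\<lambda>z. cell_trace K (glue p) z - cell_trace K' (glue p) z) | K K'.
              K \<in> T \<and> K' \<in> T \<and> K \<noteq> K' \<and> e \<in> cell_edges K \<and> e \<in> cell_edges K'}"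
        by (simp add: jumps_def interior_edge_def)
      then have "(\<forall>j\<in>jumps \<Omega> T (glue p) e. edge_integral e j = 0) \<longleftrightarrow>
        (\<forall>K\<in>T. \<forall>K'\<in>T. K \<noteq> K' \<and> e \<in> cell_edges K \<and> e \<in> cell_edges K' \<longrightarrow>
           edge_integral e (\<lambda>z. cell_trace K (glue p) z - cell_trace K' (glue p) z) = 0)"
        by auto
      also have "\<dots> \<longleftrightarrow> (\<forall>K\<in>T. \<forall>K'\<in>T. e \<in> cell_edges K \<and> e \<in> cell_edges K' \<longrightarrow>
           edge_integral e (p K) = edge_integral e (p K'))"
        by (intro ball_cong refl) (auto simp: double)
      finally show ?thesis using True by blast
    next
      case False
      then have "jumps \<Omega> T (glue p) e = {cell_trace K (glue p) | K. K \<in> T \<and> e \<in> cell_edges K}"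
        using e by (simp add: jumps_def interior_edge_def)
      then have "(\<forall>j\<in>jumps \<Omega> T (glue p) e. edge_integral e j = 0) \<longleftrightarrow>
        (\<forall>K\<in>T. e \<in> cell_edges K \<longrightarrow> edge_integral e (cell_trace K (glue p)) = 0)"
        by auto
      also have "\<dots> \<longleftrightarrow> (\<forall>K\<in>T. e \<in> cell_edges K \<longrightarrow> edge_integral e (p K) = 0)"
        by (intro ball_cong refl) (auto simp: single)
      finally show ?thesis using False by simp
    qed
    then show ?thesis by (simp add: edge_matched_def)
  qed
  have L2: "glue p \<in> L2 \<Omega>" if "\<forall>K\<in>T. p K \<in> EQ_shape" for p
    using that by (intro patch_L2[OF patch_glue] C1_continuous EQ_shape_C1) blast
  have "v \<in> EQ_space \<Omega> T \<longleftrightarrow> v \<in> L2 \<Omega> \<and> (\<exists>p. (\<forall>K\<in>T. p K \<in> EQ_shape) \<and> v = glue p) \<and>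
      (\<forall>e\<in>mesh_edges T. \<forall>j\<in>jumps \<Omega> T v e. edge_integral e j = 0)"
    by (simp add: EQ_space_def piecewise_iff conj_assoc)
  also have "\<dots> \<longleftrightarrow> (\<exists>p. v = glue p \<and> (\<forall>K\<in>T. p K \<in> EQ_shape) \<and> edge_matched p)"
  proof (intro iffI; elim conjE exE)
    fix p assume "\<forall>e\<in>mesh_edges T. \<forall>j\<in>jumps \<Omega> T v e. edge_integral e j = 0"
      "\<forall>K\<in>T. p K \<in> EQ_shape" "v = glue p"
    then show "\<exists>p. v = glue p \<and> (\<forall>K\<in>T. p K \<in> EQ_shape) \<and> edge_matched p"
      using jump_iff[of p] by (intro exI[of _ p]) simp
  next
    fix p assume p: "v = glue p" "\<forall>K\<in>T. p K \<in> EQ_shape" "edge_matched p"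
    have "\<exists>p. (\<forall>K\<in>T. p K \<in> EQ_shape) \<and> v = glue p" using p by blast
    then show "v \<in> L2 \<Omega> \<and> (\<exists>p. (\<forall>K\<in>T. p K \<in> EQ_shape) \<and> v = glue p) \<and>
      (\<forall>e\<in>mesh_edges T. \<forall>j\<in>jumps \<Omega> T v e. edge_integral e j = 0)"
      using p jump_iff[of p] L2[of p] by simp
  qed
  finally show ?thesis .
qed

lemma EQ_patch:
  assumes "\<forall>K\<in>T. p K \<in> EQ_shape"
  shows "patch (glue p) p"
  using assms by (intro patch_glue C1_continuous EQ_shape_C1) blast

text \<open>Differentiation at a point of an open cell sees only the function of that cell, so the
  elementwise gradient is the glued family of gradients.\<close>

lemma EQ_coefficients:
  assumes "\<forall>K\<in>T. p K \<in> EQ_shape"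
  obtains c where "\<And>K. K \<in> T \<Longrightarrow> grad (p K) = rt_fun (c K)" "grad_h T (glue p) = rt_glue c"
proof -
  have "\<forall>K\<in>T. \<exists>c. grad (p K) = rt_fun c" using assms EQ_shape_grad by blast
  then obtain c where c: "\<And>K. K \<in> T \<Longrightarrow> grad (p K) = rt_fun (c K)" by metis
  have "grad_h T (glue p) z = rt_glue c z" for z
  proof (cases "z \<in> (\<Union>K\<in>T. box (fst K) (snd K))")
    case True
    then obtain K where K: "K \<in> T" "z \<in> box (fst K) (snd K)" by blast
    have "p K differentiable at z"
      using EQ_shape_C1 assms K(1) by (auto simp: C1_def)
    then have "frechet_derivative (p K) (at z) = frechet_derivative (glue p) (at z)"
      by (rule frechet_derivative_transform_within_open[OF _ open_box K(2)]) (simp add: glue_eq[OF K(1)])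
    then have "grad (glue p) z = rt_fun (c K) z"
      using c[OF K(1)] by (metis grad_def)
    then show ?thesis using True K by (simp add: grad_h_def case_prod_unfold glue_eq)
  next
    case False
    then show ?thesis by (simp add: grad_h_def case_prod_unfold glue_outside)
  qed
  then show thesis using that c by blast
qed

lemma rt_glue_uminus: "rt_glue (\<lambda>K. - c K) = (\<lambda>z. - rt_glue c z)"
proof
  fix z
  show "rt_glue (\<lambda>K. - c K) z = - rt_glue c z"
  proof (cases "z \<in> (\<Union>K\<in>T. box (fst K) (snd K))")
    case True
    then obtain K where "K \<in> T" "z \<in> box (fst K) (snd K)" by blast
    then show ?thesis by (simp add: glue_eq rt_fun_uminus)
  qed (simp add: glue_outside)
qed

text \<open>The prescribed integral \<open>m\<close> depends on the edge alone, which makes both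
  sides of an interior edge match.\<close>

lemma EQ_space_dofs:
  assumes "\<And>e. e \<in> mesh_edges T \<Longrightarrow> \<not> interior_edge e \<Longrightarrow> m e = 0"
  obtains q where "\<And>K. K \<in> T \<Longrightarrow> q K \<in> EQ_shape" "glue q \<in> EQ_space \<Omega> T"
    "\<And>K. K \<in> T \<Longrightarrow> cell_integral K (q K) = w K"
    "\<And>K e. K \<in> T \<Longrightarrow> e \<in> cell_edges K \<Longrightarrow> edge_integral e (q K) = m e"
proof -
  have "\<forall>K\<in>T. \<exists>q. q \<in> EQ_shape \<and> cell_integral K q = w K \<and> (\<forall>e\<in>cell_edges K. edge_integral e q = m e)"
    using EQ_shape_unisolvent by (metis cell_shape)
  then obtain q where q: "\<forall>K\<in>T. q K \<in> EQ_shape \<and> cell_integral K (q K) = w K \<and> (\<forall>e\<in>cell_edges K. edge_integral e (q K) = m e)"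
    by metis
  then have "edge_matched q" using assms by (simp add: edge_matched_def)
  then have "glue q \<in> EQ_space \<Omega> T" using q EQ_space_iff by blast
  with q that show thesis by blast
qed

text \<open>Here \<open>m\<close> also depends on the cell: off the interior edges, in particular on
  a slit, the flux may be prescribed separately from each side.\<close>

lemma RT_space_dofs:
  assumes "\<And>e K K'. interior_edge e \<Longrightarrow> K \<in> T \<Longrightarrow> K' \<in> T \<Longrightarrow> e \<in> cell_edges K \<Longrightarrow> e \<in> cell_edges K' \<Longrightarrow> m K e = m K' e"
  obtains c where "flux_matched c" "\<And>K e. K \<in> T \<Longrightarrow> e \<in> cell_edges K \<Longrightarrow> flux (c K) e = m K e"
proof -
  have "\<forall>K\<in>T. \<exists>c. \<forall>e\<in>cell_edges K. flux c e = m K e"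
    using RT_unisolvent by (metis cell_shape)
  then obtain c where c: "\<forall>K\<in>T. \<forall>e\<in>cell_edges K. flux (c K) e = m K e" by metis
  have "flux_matched c"
    unfolding flux_matched_def
  proof (intro allI impI)
    fix e K K'
    assume e: "interior_edge e" "K \<in> T" "K' \<in> T" "e \<in> cell_edges K" "e \<in> cell_edges K'"
    have "flux (c K) e = m K e" "flux (c K') e = m K' e" using c e by auto
    then show "flux (c K) e = flux (c K') e" using assms[OF e] by (simp only:)
  qed
  with c that show thesis by blast
qed

lemma l2_inner_grad_h:
  assumes "\<And>K. K \<in> T \<Longrightarrow> grad (q K) = rt_fun (d K)"
  shows "l2_inner \<Omega> (rt_glue c) (rt_glue d) = (\<Sum>K\<in>T. cell_integral K (\<lambda>z. grad (q K) z \<bullet> rt_fun (c K) z))"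
  unfolding l2_inner_patch[OF patch_rt patch_rt] using assms
  by (intro sum.cong refl) (simp add: inner_commute)

lemma PEQ_imp_RRT:
  assumes "(lam, u) \<in> PEQ_eigenpairs \<Omega> T"
  shows "(lam, (\<lambda>z. - grad_h T u z), proj0 \<Omega> T u) \<in> RRT_eigenpairs \<Omega> T"
proof -
  from assms have u: "u \<in> EQ_space \<Omega> T" and norm: "l2_norm \<Omega> (proj0 \<Omega> T u) = 1"
    and eq: "\<And>v. v \<in> EQ_space \<Omega> T \<Longrightarrow> l2_inner \<Omega> (grad_h T u) (grad_h T v) = lam * l2_inner \<Omega> (proj0 \<Omega> T u) v"
    by (auto simp: PEQ_eigenpairs_def)
  obtain p where p: "u = glue p" "\<forall>K\<in>T. p K \<in> EQ_shape" "edge_matched p"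
    using u EQ_space_iff by blast
  obtain c where c: "\<And>K. K \<in> T \<Longrightarrow> grad (p K) = rt_fun (c K)" "grad_h T u = rt_glue c"
    using EQ_coefficients[OF p(2)] p(1) by metis
  define W where "W K = cell_integral K (p K) / area K" for K
  have P: "proj0 \<Omega> T u = glue (\<lambda>K z. W K)"
    unfolding p(1) W_def by (rule proj0_patch[OF EQ_patch[OF p(2)]])
  \<comment> \<open>The eigenvalue equation tested with the \<open>EQ\<close> function that has edge
    integrals \<open>m\<close> and cell integrals \<open>w\<close>. Nothing is known about the
    fluxes yet, so Green's formula leaves their edge sums; \<open>m\<close> and \<open>w\<close> can
    be varied independently.\<close>
  have test: "(\<Sum>e\<in>mesh_edges T. (\<Sum>K\<in>{K\<in>T. e \<in> cell_edges K}. osign K e * flux (c K) e) * m e)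
      - (\<Sum>K\<in>T. w K * rt_div (c K)) = lam * (\<Sum>K\<in>T. w K * W K)"
    if m: "\<And>e. e \<in> mesh_edges T \<Longrightarrow> \<not> interior_edge e \<Longrightarrow> m e = 0" for m w
  proof -
    obtain q where q: "\<And>K. K \<in> T \<Longrightarrow> q K \<in> EQ_shape" "glue q \<in> EQ_space \<Omega> T"
      "\<And>K. K \<in> T \<Longrightarrow> cell_integral K (q K) = w K"
      "\<And>K e. K \<in> T \<Longrightarrow> e \<in> cell_edges K \<Longrightarrow> edge_integral e (q K) = m e"
      using EQ_space_dofs[of m w, OF m] by blast
    have qE: "\<forall>K\<in>T. q K \<in> EQ_shape" using q(1) by blast
    obtain d where d: "\<And>K. K \<in> T \<Longrightarrow> grad (q K) = rt_fun (d K)" "grad_h T (glue q) = rt_glue d"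
      using EQ_coefficients[OF qE] by blast
    have "l2_inner \<Omega> (proj0 \<Omega> T u) (glue q) = (\<Sum>K\<in>T. w K * W K)"
      unfolding P by (simp add: l2_inner_commute[of _ "glue q"] l2_inner_P0[OF EQ_patch[OF qE]] q(3))
    then have "(\<Sum>K\<in>T. cell_integral K (\<lambda>z. grad (q K) z \<bullet> rt_fun (c K) z)) = lam * (\<Sum>K\<in>T. w K * W K)"
      using eq[OF q(2)] l2_inner_grad_h[OF d(1), where c=c] by (simp add: c(2) d(2))
    moreover have "(\<Sum>K\<in>T. cell_integral K (\<lambda>z. grad (q K) z \<bullet> rt_fun (c K) z)) + (\<Sum>K\<in>T. cell_integral K (q K) * rt_div (c K)) =
        (\<Sum>e\<in>mesh_edges T. \<Sum>K\<in>{K\<in>T. e \<in> cell_edges K}. osign K e * (flux (c K) e * edge_integral e (q K)))"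
      by (rule green_mesh) (rule EQ_shape_C1[OF q(1)])
    moreover have "\<dots> = (\<Sum>e\<in>mesh_edges T. (\<Sum>K\<in>{K\<in>T. e \<in> cell_edges K}. osign K e * flux (c K) e) * m e)"
      by (intro sum.cong refl) (simp add: sum_distrib_right q(4) mult.assoc)
    ultimately show ?thesis by (simp add: q(3) algebra_simps)
  qed
  \<comment> \<open>The bubble of \<open>K\<close>: all edge integrals zero, cell integral 1 on
    \<open>K\<close> alone.\<close>
  have div: "- rt_div (c K) = lam * W K" if K: "K \<in> T" for K
    using test[of "\<lambda>e. 0" "\<lambda>K'. if K' = K then 1 else 0"] K finite_T
    by (simp add: if_distrib[of "\<lambda>a. a * _"] cong: if_cong)
  have "(\<Sum>K\<in>{K\<in>T. e \<in> cell_edges K}. osign K e * flux (c K) e) = 0" if e: "interior_edge e" for e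
  proof -
    \<comment> \<open>Edge integral 1 on \<open>e\<close> alone and all cell integrals zero, which
      is admissible because \<open>e\<close> is interior.\<close>
    have "(\<Sum>e'\<in>mesh_edges T. (\<Sum>K\<in>{K\<in>T. e' \<in> cell_edges K}. osign K e' * flux (c K) e') * (if e' = e then 1 else 0))
        - (\<Sum>K\<in>T. 0 * rt_div (c K)) = lam * (\<Sum>K\<in>T. 0 * W K)"
      by (rule test) (use e in auto)
    then show ?thesis
      using e finite_mesh_edges by (simp add: interior_edge_def if_distrib[of "(*) _"] cong: if_cong)
  qed
  then have "flux_matched c" using flux_matched_iff by blast
  define s where "s = (\<lambda>K. - c K)"
  have s: "flux_matched s"
    using \<open>flux_matched c\<close> unfolding flux_matched_def s_def rt_fun_uminus(3) neg_equal_iff_equal .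
  have \<sigma>: "(\<lambda>z. - grad_h T u z) = rt_glue s"
    unfolding c(2) s_def by (rule rt_glue_uminus[symmetric])
  have eq1: "l2_inner \<Omega> (rt_glue s) \<tau> - l2_inner \<Omega> (weak_div \<Omega> \<tau>) (glue (\<lambda>K z. W K)) = 0"
    if tau: "\<tau> \<in> RT_space \<Omega> T" for \<tau>
  proof -
    obtain t where t: "\<tau> = rt_glue t" "flux_matched t" using tau RT_space_iff by blast
    have "l2_inner \<Omega> (rt_glue s) \<tau> = - l2_inner \<Omega> (rt_glue t) (rt_glue c)"
      unfolding t(1) by (simp add: s_def rt_glue_uminus l2_inner_commute[of "rt_glue t"]) (simp add: l2_inner_def)
    also have "\<dots> = (\<Sum>K\<in>T. cell_integral K (p K) * rt_div (t K))"
      using green_matched[OF EQ_shape_C1 t(2) p(3)] p(2) l2_inner_grad_h[OF c(1), where c=t] by simp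
    also have "\<dots> = l2_inner \<Omega> (weak_div \<Omega> \<tau>) (glue (\<lambda>K z. W K))"
      unfolding t(1) l2_inner_weak_div[OF t(2)]
      by (intro sum.cong refl) (use area_pos in \<open>force simp: W_def\<close>)
    finally show ?thesis by simp
  qed
  have eq2: "l2_inner \<Omega> (weak_div \<Omega> (rt_glue s)) v = lam * l2_inner \<Omega> (glue (\<lambda>K z. W K)) v"
    if v: "v \<in> P0_space \<Omega> T" for v
  proof -
    obtain w where w: "v = glue (\<lambda>K z. w K)" using v P0_space_eq by auto
    have "rt_div (s K) = lam * W K" if "K \<in> T" for K
      using div[OF that] by (simp add: s_def rt_fun_uminus)
    then show ?thesis
      by (simp add: w l2_inner_weak_div[OF s] l2_inner_P0[OF patch_const] cell_integral_const sum_distrib_left mult.assoc)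
  qed
  have "rt_glue s \<in> RT_space \<Omega> T" using s RT_space_iff by blast
  then show ?thesis
    using norm eq1 eq2 P0_spaceI[of W] by (simp add: RRT_eigenpairs_def \<sigma> P)
qed

text \<open>On each cell the gradient fixes the polynomial up to a constant, and the cell mean fixes
  the constant.\<close>

lemma PEQ_determined:
  assumes "u \<in> EQ_space \<Omega> T" "u' \<in> EQ_space \<Omega> T" "grad_h T u = grad_h T u'" "proj0 \<Omega> T u = proj0 \<Omega> T u'"
  shows "u = u'"
proof -
  obtain p where p: "u = glue p" "\<forall>K\<in>T. p K \<in> EQ_shape" using assms(1) EQ_space_iff by blast
  obtain p' where p': "u' = glue p'" "\<forall>K\<in>T. p' K \<in> EQ_shape" using assms(2) EQ_space_iff by blast
  obtain c where c: "\<And>K. K \<in> T \<Longrightarrow> grad (p K) = rt_fun (c K)" "grad_h T u = rt_glue c"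
    using EQ_coefficients[OF p(2)] p(1) by metis
  obtain c' where c': "\<And>K. K \<in> T \<Longrightarrow> grad (p' K) = rt_fun (c' K)" "grad_h T u' = rt_glue c'"
    using EQ_coefficients[OF p'(2)] p'(1) by metis
  have "p K z = p' K z" if K: "K \<in> T" for K z
  proof -
    obtain a1 a2 b1 b2 where shape: "K = ((a1, a2), (b1, b2))" "a1 < b1" "a2 < b2"
      using cell_shape[OF K] by blast
    have "rt_fun (c K) z = rt_fun (c' K) z" if "z \<in> box (a1, a2) (b1, b2)" for z
      using assms(3) glue_eq[OF K, of z "\<lambda>K. rt_fun (c K)"] glue_eq[OF K, of z "\<lambda>K. rt_fun (c' K)"] that
      by (simp add: c(2) c'(2) shape(1))
    then have "c K = c' K" by (rule rt_fun_eq_on_box[OF shape(2,3)])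
    then have "grad (p K) = grad (p' K)" using c(1) c'(1) K by simp
    then obtain k where k: "\<forall>z. p K z = p' K z + k"
      using C1_eq_of_grad_eq EQ_shape_C1 p(2) p'(2) K by blast
    have m: "((a1 + b1) / 2, (a2 + b2) / 2) \<in> box (fst K) (snd K)"
      using shape by (simp add: mem_box_Pair)
    let ?W = "\<lambda>p K. cell_integral K (p K) / area K"
    have W: "glue (\<lambda>K z. ?W p K) = glue (\<lambda>K z. ?W p' K)"
      using assms(4) unfolding p(1) p'(1) proj0_patch[OF EQ_patch[OF p(2)]] proj0_patch[OF EQ_patch[OF p'(2)]] .
    have "?W p K = ?W p' K"
      using fun_cong[OF W] glue_eq[OF K m, of "\<lambda>K z. ?W p K"] glue_eq[OF K m, of "\<lambda>K z. ?W p' K"]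
      by metis
    moreover have "cell_integral K (\<lambda>z. p' K z + k) = cell_integral K (p' K) + k * area K"
      using cell_integral_add[OF C1_continuous[OF EQ_shape_C1[OF bspec[OF p'(2) K]]] continuous_on_const[of _ k], of K]
      by (simp add: cell_integral_const)
    moreover have "p K = (\<lambda>z. p' K z + k)" using k by blast
    ultimately show ?thesis using area_pos[OF K] by simp
  qed
  then show ?thesis unfolding p(1) p'(1) by (intro glue_cong) simp
qed

lemma RRT_imp_PEQ:
  assumes "(lam, \<sigma>, w) \<in> RRT_eigenpairs \<Omega> T"
  obtains u where "(lam, u) \<in> PEQ_eigenpairs \<Omega> T" "\<sigma> = (\<lambda>z. - grad_h T u z)" "w = proj0 \<Omega> T u"
proof -
  from assms have \<sigma>: "\<sigma> \<in> RT_space \<Omega> T" and w: "w \<in> P0_space \<Omega> T" and norm: "l2_norm \<Omega> w = 1"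
    and eq1: "\<And>\<tau>. \<tau> \<in> RT_space \<Omega> T \<Longrightarrow> l2_inner \<Omega> \<sigma> \<tau> - l2_inner \<Omega> (weak_div \<Omega> \<tau>) w = 0"
    and eq2: "\<And>v. v \<in> P0_space \<Omega> T \<Longrightarrow> l2_inner \<Omega> (weak_div \<Omega> \<sigma>) v = lam * l2_inner \<Omega> w v"
    by (auto simp: RRT_eigenpairs_def)
  obtain s where s: "\<sigma> = rt_glue s" "flux_matched s" using \<sigma> RT_space_iff by blast
  obtain W where W: "w = glue (\<lambda>K z. W K)" using w P0_space_eq by auto
  \<comment> \<open>The cell integrals are chosen such that the projection of the glued function is
    \<open>w\<close>.\<close>
  have "\<forall>K\<in>T. \<exists>p. p \<in> EQ_shape \<and> grad p = rt_fun (- s K) \<and> cell_integral K p = W K * area K"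
    using EQ_shape_of_grad by (metis cell_shape)
  then obtain p where p: "\<forall>K\<in>T. p K \<in> EQ_shape \<and> grad (p K) = rt_fun (- s K) \<and> cell_integral K (p K) = W K * area K"
    by metis
  then have pE: "\<forall>K\<in>T. p K \<in> EQ_shape" and pg: "\<And>K. K \<in> T \<Longrightarrow> grad (p K) = rt_fun (- s K)"
    and pi: "\<And>K. K \<in> T \<Longrightarrow> cell_integral K (p K) = W K * area K" by auto
  define u where "u = glue p"
  obtain c where c: "\<And>K. K \<in> T \<Longrightarrow> grad (p K) = rt_fun (c K)" "grad_h T u = rt_glue c"
    using EQ_coefficients[OF pE] u_def by metis
  have "rt_glue c = rt_glue (\<lambda>K. - s K)"
    using c(1) pg by (intro glue_cong) metis
  then have gu: "grad_h T u = (\<lambda>z. - \<sigma> z)"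
    unfolding c(2) s(1) rt_glue_uminus .
  have Pu: "proj0 \<Omega> T u = w"
    unfolding u_def W proj0_patch[OF EQ_patch[OF pE]] using pi area_pos by (intro glue_cong) force
  have inner: "l2_inner \<Omega> \<sigma> (rt_glue t) = - (\<Sum>K\<in>T. cell_integral K (\<lambda>z. grad (p K) z \<bullet> rt_fun (t K) z))" for t
    using l2_inner_grad_h[of p "\<lambda>K. - s K" t, OF pg]
    by (simp add: rt_glue_uminus s(1) l2_inner_commute[of "rt_glue s"]) (simp add: l2_inner_def)
  \<comment> \<open>What remains of the first mixed equation after Green's formula: the divergence
    terms cancel because \<open>p\<close> has the cell integrals of \<open>w\<close>, and the fluxes
    \<open>m\<close> are arbitrary apart from being single-valued on interior edges.\<close>
  have test: "(\<Sum>e\<in>mesh_edges T. \<Sum>K\<in>{K\<in>T. e \<in> cell_edges K}. osign K e * (m K e * edge_integral e (p K))) = 0"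
    if m: "\<And>e K K'. interior_edge e \<Longrightarrow> K \<in> T \<Longrightarrow> K' \<in> T \<Longrightarrow> e \<in> cell_edges K \<Longrightarrow> e \<in> cell_edges K' \<Longrightarrow> m K e = m K' e"
    for m :: "cell \<Rightarrow> edge \<Rightarrow> real"
  proof -
    obtain t where t: "flux_matched t" "\<And>K e. K \<in> T \<Longrightarrow> e \<in> cell_edges K \<Longrightarrow> flux (t K) e = m K e"
      using RT_space_dofs[of m, OF m] by blast
    have "rt_glue t \<in> RT_space \<Omega> T" using t(1) RT_space_iff by blast
    from eq1[OF this] have "(\<Sum>K\<in>T. cell_integral K (\<lambda>z. grad (p K) z \<bullet> rt_fun (t K) z)) + (\<Sum>K\<in>T. cell_integral K (p K) * rt_div (t K)) = 0"
      by (simp add: inner W l2_inner_weak_div[OF t(1)] pi mult_ac)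
    then show ?thesis
      using green_mesh[of p t] EQ_shape_C1 pE by (simp add: t(2))
  qed
  have "edge_matched p"
    unfolding edge_matched_def
  proof (intro ballI impI conjI)
    fix e K assume e: "e \<in> mesh_edges T" and K: "K \<in> T" "e \<in> cell_edges K"
    show "edge_integral e (p K) = 0" if ni: "\<not> interior_edge e"
    proof -
      \<comment> \<open>A unit flux on one edge seen from one cell only, admissible since
        \<open>e\<close> is not interior; this isolates a single edge integral, up to the nonzero
        sign \<open>osign\<close>.\<close>
      let ?m = "\<lambda>K' e'. if K' = K \<and> e' = e then 1 else 0 :: real"
      have "(\<Sum>K'\<in>{K'\<in>T. e' \<in> cell_edges K'}. osign K' e' * (?m K' e' * edge_integral e' (p K'))) =
          (if e' = e then osign K e * edge_integral e (p K) else 0)" for e'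
      proof -
        have "(\<Sum>K'\<in>{K'\<in>T. e' \<in> cell_edges K'}. osign K' e' * (?m K' e' * edge_integral e' (p K'))) =
          (\<Sum>K'\<in>{K'\<in>T. e' \<in> cell_edges K'}. if K' = K then (if e' = e then osign K e * edge_integral e (p K) else 0) else 0)"
          by (intro sum.cong refl) auto
        then show ?thesis using finite_T K by auto
      qed
      moreover have "(\<Sum>e'\<in>mesh_edges T. \<Sum>K'\<in>{K'\<in>T. e' \<in> cell_edges K'}. osign K' e' * (?m K' e' * edge_integral e' (p K'))) = 0"
        by (rule test) (use ni in auto)
      ultimately have "osign K e * edge_integral e (p K) = 0"
        using e finite_mesh_edges by simp
      then show ?thesis by (simp add: osign_def split: if_splits)
    qed
    fix K' assume K': "K' \<in> T" "e \<in> cell_edges K'" and i: "interior_edge e"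
    \<comment> \<open>A unit flux through the interior edge \<open>e\<close>, the same from both
      cells, leaves the difference of the two edge integrals.\<close>
    have "(\<Sum>K\<in>{K\<in>T. e' \<in> cell_edges K}. osign K e' * ((if e' = e then 1 else 0) * edge_integral e' (p K))) =
        (if e' = e then \<Sum>K\<in>{K\<in>T. e \<in> cell_edges K}. osign K e * edge_integral e (p K) else 0)" for e'
      by simp
    then have "(\<Sum>K\<in>{K\<in>T. e \<in> cell_edges K}. osign K e * edge_integral e (p K)) = 0"
      using test[of "\<lambda>K e'. if e' = e then 1 else 0"] e finite_mesh_edges by simp
    then show "edge_integral e (p K) = edge_integral e (p K')"
      unfolding interior_edge_sum[OF i] using K K' by blast
  qed
  then have u: "u \<in> EQ_space \<Omega> T" using pE u_def EQ_space_iff by blast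
  have div: "rt_div (s K) = lam * W K" if K: "K \<in> T" for K
  proof -
    let ?v = "\<lambda>K'. if K' = K then 1 else 0 :: real"
    have "(\<Sum>K'\<in>T. rt_div (s K') * area K' * ?v K') = lam * (\<Sum>K'\<in>T. W K' * area K' * ?v K')"
      using eq2[OF P0_spaceI[of ?v]] unfolding s(1) W l2_inner_weak_div[OF s(2)] l2_inner_P0[OF patch_const] cell_integral_const .
    then show ?thesis using K finite_T area_pos[OF K] by (simp add: if_distrib cong: if_cong)
  qed
  have "l2_inner \<Omega> (grad_h T u) (grad_h T v) = lam * l2_inner \<Omega> w v" if v: "v \<in> EQ_space \<Omega> T" for v
  proof -
    obtain q where q: "v = glue q" "\<forall>K\<in>T. q K \<in> EQ_shape" "edge_matched q"
      using v EQ_space_iff by blast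
    obtain d where d: "\<And>K. K \<in> T \<Longrightarrow> grad (q K) = rt_fun (d K)" "grad_h T v = rt_glue d"
      using EQ_coefficients[OF q(2)] q(1) by metis
    have "l2_inner \<Omega> (grad_h T u) (grad_h T v) = - l2_inner \<Omega> (rt_glue s) (rt_glue d)"
      by (simp add: gu d(2) s(1)) (simp add: l2_inner_def)
    also have "\<dots> = (\<Sum>K\<in>T. cell_integral K (q K) * rt_div (s K))"
      using green_matched[OF EQ_shape_C1 s(2) q(3)] q(2) l2_inner_grad_h[of q d s, OF d(1)] by simp
    also have "\<dots> = lam * (\<Sum>K\<in>T. cell_integral K (q K) * W K)"
      by (simp add: div sum_distrib_left mult_ac)
    also have "\<dots> = lam * l2_inner \<Omega> w v"
      unfolding W q(1) l2_inner_commute[of _ "glue q"] l2_inner_P0[OF EQ_patch[OF q(2)]] ..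
    finally show ?thesis .
  qed
  then have "(lam, u) \<in> PEQ_eigenpairs \<Omega> T"
    using u norm by (simp add: PEQ_eigenpairs_def Pu)
  then show thesis using that[of u] gu Pu by simp
qed

end

theorem corollary1:
  fixes \<Omega> :: "point set" and x y :: "nat \<Rightarrow> real" and n1 n2 :: nat
  assumes "open \<Omega>" and "connected \<Omega>" and "\<Omega> \<noteq> {}" and "bounded \<Omega>"
    and "rect_mesh \<Omega> n1 x n2 y"
  defines "T \<equiv> mesh \<Omega> n1 x n2 y"
  shows "\<exists>\<Phi>. bij_betw \<Phi> (PEQ_eigenpairs \<Omega> T) (RRT_eigenpairs \<Omega> T) \<and>
    (\<forall>lamP uP lamR \<sigma>R uR. (lamP, uP) \<in> PEQ_eigenpairs \<Omega> T \<longrightarrow>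
       \<Phi> (lamP, uP) = (lamR, \<sigma>R, uR) \<longrightarrow>
       lamR = lamP \<and> \<sigma>R = (\<lambda>z. - grad_h T uP z) \<and> uR = proj0 \<Omega> T uP)"
proof -
  interpret D: rect_domain \<Omega> x y n1 n2
    by (rule rect_domain.intro[OF assms(1,4,5)])
  define \<Phi> where "\<Phi> = (\<lambda>(lam :: real, u). (lam, (\<lambda>z. - grad_h T u z), proj0 \<Omega> T u))"
  have "bij_betw \<Phi> (PEQ_eigenpairs \<Omega> T) (RRT_eigenpairs \<Omega> T)"
  proof (rule bij_betwI')
    fix a b assume ab: "a \<in> PEQ_eigenpairs \<Omega> T" "b \<in> PEQ_eigenpairs \<Omega> T"
    obtain l u l' u' where a: "a = (l, u)" and b: "b = (l', u')" by fastforce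
    have "u = u'" if "(\<lambda>z. - grad_h T u z) = (\<lambda>z. - grad_h T u' z)" "proj0 \<Omega> T u = proj0 \<Omega> T u'"
    proof (rule D.PEQ_determined[folded T_def])
      show "grad_h T u = grad_h T u'"
        using fun_cong[OF that(1)] by auto
    qed (use ab a b that in \<open>auto simp: PEQ_eigenpairs_def\<close>)
    then show "(\<Phi> a = \<Phi> b) = (a = b)" by (auto simp: \<Phi>_def a b)
  next
    fix a assume "a \<in> PEQ_eigenpairs \<Omega> T"
    then show "\<Phi> a \<in> RRT_eigenpairs \<Omega> T"
      using D.PEQ_imp_RRT[folded T_def] by (cases a) (auto simp: \<Phi>_def)
  next
    fix b assume b: "b \<in> RRT_eigenpairs \<Omega> T"
    obtain l \<sigma> w where lw: "b = (l, \<sigma>, w)" by (metis prod_cases3)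
    obtain u where "(l, u) \<in> PEQ_eigenpairs \<Omega> T" "\<sigma> = (\<lambda>z. - grad_h T u z)" "w = proj0 \<Omega> T u"
      using D.RRT_imp_PEQ[folded T_def, OF b[unfolded lw]] by blast
    then show "\<exists>a\<in>PEQ_eigenpairs \<Omega> T. b = \<Phi> a"
      by (intro bexI[of _ "(l, u)"]) (auto simp: \<Phi>_def lw)
  qed
  moreover have "\<forall>lamP uP lamR \<sigma>R uR. (lamP, uP) \<in> PEQ_eigenpairs \<Omega> T \<longrightarrow>
       \<Phi> (lamP, uP) = (lamR, \<sigma>R, uR) \<longrightarrow>
       lamR = lamP \<and> \<sigma>R = (\<lambda>z. - grad_h T uP z) \<and> uR = proj0 \<Omega> T uP"
    by (auto simp: \<Phi>_def)
  ultimately show ?thesis by blast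
qed

end
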